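(* Let $\alpha,\beta>0$. The set $$\mathcal{M}_1(\alpha,\beta,(A_0,A_1))=\{a\in\mathcal{M}(\alpha,\beta,(A_0,A_1));\ \|a_{00}^{-1}a_{01}\|\le\beta,\ \|a_{10}a_{00}^{-1}\|\le\beta\}$$ is compact under $\tau_H$.
   Context: Hilbert spaces are complex; $L(K_0,K_1)$ denotes bounded linear operators, $L(K)=L(K,K)$. For $T\in L(K)$, $\operatorname{Re}T=\frac12(T+T^* )$, and $\operatorname{Re}T\ge c$ means $\operatorname{Re}\langle T\phi,\phi\rangle\ge c\|\phi\|^2$ for all $\phi$. Standing setting: $H_0,H_1,H_2$ are Hilbert spaces; $A_0:\operatorname{dom}(A_0)\subseteq H_0\to H_1$ and $A_1:\operatorname{dom}(A_1)\subseteq H_1\to H_2$ are densely defined closed linear operators; $(A_0,A_1)$ is closed and exact, i.e. $\operatorname{ran}(A_0)$, $\operatorname{ran}(A_1)$ are closed and $\operatorname{ran}(A_0)=\ker(A_1)$. Then $H_1=\operatorname{ran}(A_0)\oplus\operatorname{ran}(A_1^* )$ orthogonally. Let $\iota_0:\operatorname{ran}(A_0)\hookrightarrow H_1$ and $\iota_1:\operatorname{ran}(A_1^* )\hookrightarrow H_1$ be the canonical embeddings. For $a\in L(H_1)$ put $a_{jk}=\iota_j^*a\iota_k$ ($j,k\in\{0,1\}$); $a_{00}^{-1}$ means $(a_{00})^{-1}$ and $(a^{-1})_{11}^{-1}$ means $((a^{-1})_{11})^{-1}$. $\mathcal{M}(\alpha,\beta,(A_0,A_1))$ is the set of continuously invertible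 $a\in L(H_1)$ with $\operatorname{Re}a_{00}\ge\alpha$, $\operatorname{Re}a_{00}^{-1}\ge1/\beta$, $\operatorname{Re}(a^{-1})_{11}\ge1/\beta$, $\operatorname{Re}(a^{-1})_{11}^{-1}\ge\alpha$. $\tau_H$ is the initial topology on $\mathcal{M}(\alpha,\beta,(A_0,A_1))$ making the following four maps continuous, where $L_{\mathrm w}$ denotes bounded operators with the weak operator topology: $a\mapsto a_{00}^{-1}\in L_{\mathrm w}(\operatorname{ran}(A_0))$, $a\mapsto a_{10}a_{00}^{-1}\in L_{\mathrm w}(\operatorname{ran}(A_0),\operatorname{ran}(A_1^* ))$, $a\mapsto a_{00}^{-1}a_{01}\in L_{\mathrm w}(\operatorname{ran}(A_1^* ),\operatorname{ran}(A_0))$, $a\mapsto a_{11}-a_{10}a_{00}^{-1}a_{01}\in L_{\mathrm w}(\operatorname{ran}(A_1^* ))$. *)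

theory Defs
  imports "HOL-Analysis.Analysis"
begin

text \<open>
  Complex Hilbert spaces. The library only has real inner product spaces, so a complex inner
  product space is presented as a real one carrying a complex scalar multiplication and a
  sesquilinear form (linear in the first argument) whose real part is the given real inner
  product; norm and topology are thereby the usual ones, \<open>norm x = sqrt (Re (cinner x x))\<close>.
\<close>

class complex_inner = real_inner +
  fixes scaleC :: "complex \<Rightarrow> 'a \<Rightarrow> 'a"  (infixr "*\<^sub>C" 75)
    and cinner :: "'a \<Rightarrow> 'a \<Rightarrow> complex"
  assumes scaleC_add_right: "c *\<^sub>C (x + y) = c *\<^sub>C x + c *\<^sub>C y"
    and scaleC_add_left: "(c + d) *\<^sub>C x = c *\<^sub>C x + d *\<^sub>C x"
    and scaleC_scaleC: "c *\<^sub>C (d *\<^sub>C x) = (c * d) *\<^sub>C x"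
    and scaleC_of_real: "complex_of_real r *\<^sub>C x = r *\<^sub>R x"
    and cinner_commute: "cinner x y = cnj (cinner y x)"
    and cinner_add_left: "cinner (x + y) z = cinner x z + cinner y z"
    and cinner_scaleC_left: "cinner (c *\<^sub>C x) y = c * cinner x y"
    and Re_cinner: "Re (cinner x y) = inner x y"

class complex_hilbert = complex_inner + banach

instantiation complex :: complex_hilbert
begin

definition scaleC_complex :: "complex \<Rightarrow> complex \<Rightarrow> complex" where
  "scaleC_complex c x = c * x"

definition cinner_complex :: "complex \<Rightarrow> complex \<Rightarrow> complex" where
  "cinner_complex x y = x * cnj y"

instance
  by standard
    (auto simp: scaleC_complex_def cinner_complex_def inner_complex_def algebra_simps scaleR_conv_of_real)

end

text \<open>
  A possibly unbounded linear operator \<open>A\<close> from \<open>dom(A)\<close> is identified with its graph. Thus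
  \<open>dom(A)\<close> is \<open>Domain A\<close>, \<open>ran(A)\<close> is \<open>Range A\<close>, and \<open>A\<close> is a closed operator iff
  \<open>closed A\<close> in the product space.
\<close>

definition linear_operator :: "('a::complex_hilbert \<times> 'b::complex_hilbert) set \<Rightarrow> bool" where
  "linear_operator A \<longleftrightarrow> single_valued A \<and> (0, 0) \<in> A
     \<and> (\<forall>x y u v. (x, u) \<in> A \<longrightarrow> (y, v) \<in> A \<longrightarrow> (x + y, u + v) \<in> A)
     \<and> (\<forall>c x u. (x, u) \<in> A \<longrightarrow> (c *\<^sub>C x, c *\<^sub>C u) \<in> A)"

definition densely_defined :: "('a::complex_hilbert \<times> 'b::complex_hilbert) set \<Rightarrow> bool" where
  "densely_defined A \<longleftrightarrow> closure (Domain A) = UNIV"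

definition op_kernel :: "('a::complex_hilbert \<times> 'b::complex_hilbert) set \<Rightarrow> 'a set" where
  "op_kernel A = {x. (x, 0) \<in> A}"

definition op_adjoint :: "('a::complex_hilbert \<times> 'b::complex_hilbert) set \<Rightarrow> ('b \<times> 'a) set" where
  "op_adjoint A = {(y, z). \<forall>(x, w) \<in> A. cinner w y = cinner x z}"

text \<open>
  Bounded operators between (closed) subspaces \<open>U\<close>, \<open>V\<close> are extensional functions on \<open>U\<close>
  (\<open>undefined\<close> outside \<open>U\<close>), so that equality in \<open>bounded_ops U V\<close> is equality as maps on \<open>U\<close>.
\<close>

definition bounded_ops :: "'a::complex_hilbert set \<Rightarrow> 'b::complex_hilbert set \<Rightarrow> ('a \<Rightarrow> 'b) set" where
  "bounded_ops U V = {T \<in> U \<rightarrow>\<^sub>E V.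
     (\<forall>x\<in>U. \<forall>y\<in>U. T (x + y) = T x + T y) \<and>
     (\<forall>c. \<forall>x\<in>U. T (c *\<^sub>C x) = c *\<^sub>C T x) \<and>
     (\<exists>K. \<forall>x\<in>U. norm (T x) \<le> K * norm x)}"

definition onorm_on :: "'a::complex_hilbert set \<Rightarrow> ('a \<Rightarrow> 'b::complex_hilbert) \<Rightarrow> real" where
  "onorm_on U T = (SUP x\<in>U. norm (T x) / norm x)"

definition bop_adjoint ::
  "'a::complex_hilbert set \<Rightarrow> 'b::complex_hilbert set \<Rightarrow> ('a \<Rightarrow> 'b) \<Rightarrow> 'b \<Rightarrow> 'a" where
  "bop_adjoint U V T = (\<lambda>y\<in>V. THE x. x \<in> U \<and> (\<forall>u\<in>U. cinner (T u) y = cinner u x))"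

definition bop_inverse ::
  "'a::complex_hilbert set \<Rightarrow> 'b::complex_hilbert set \<Rightarrow> ('a \<Rightarrow> 'b) \<Rightarrow> 'b \<Rightarrow> 'a" where
  "bop_inverse U V T = (\<lambda>y\<in>V. inv_into U T y)"

definition continuously_invertible ::
  "'a::complex_hilbert set \<Rightarrow> 'b::complex_hilbert set \<Rightarrow> ('a \<Rightarrow> 'b) \<Rightarrow> bool" where
  "continuously_invertible U V T \<longleftrightarrow> bij_betw T U V \<and> bop_inverse U V T \<in> bounded_ops V U"

definition Re_ge :: "'a::complex_hilbert set \<Rightarrow> ('a \<Rightarrow> 'a) \<Rightarrow> real \<Rightarrow> bool" where
  "Re_ge U T c \<longleftrightarrow> (\<forall>\<phi>\<in>U. Re (cinner (T \<phi>) \<phi>) \<ge> c * (norm \<phi>)\<^sup>2)"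

definition embedding :: "'a::complex_hilbert set \<Rightarrow> 'a \<Rightarrow> 'a" where
  "embedding U = (\<lambda>x\<in>U. x)"

text \<open>\<open>block U V a\<close> is \<open>\<iota>\<^sub>U\<^sup>* a \<iota>\<^sub>V\<close>, an operator from \<open>V\<close> to \<open>U\<close>.\<close>

definition block :: "'a::complex_hilbert set \<Rightarrow> 'a set \<Rightarrow> ('a \<Rightarrow> 'a) \<Rightarrow> 'a \<Rightarrow> 'a" where
  "block U V a = compose V (bop_adjoint U UNIV (embedding U)) (compose V a (embedding V))"

definition initial_topology :: "'a set \<Rightarrow> (('a \<Rightarrow> 'b) \<times> 'b topology) set \<Rightarrow> 'a topology" where
  "initial_topology S F =
     topology_generated_by (insert S {{a \<in> S. f a \<in> W} | f X W. (f, X) \<in> F \<and> openin X W})"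

definition weak_op_topology ::
  "'a::complex_hilbert set \<Rightarrow> 'b::complex_hilbert set \<Rightarrow> ('a \<Rightarrow> 'b) topology" where
  "weak_op_topology U V =
     initial_topology (bounded_ops U V) {(\<lambda>T. cinner (T x) y, euclidean) | x y. x \<in> U \<and> y \<in> V}"

text \<open>The four maps of the block decomposition; \<open>X\<^sub>0\<close>, \<open>X\<^sub>1\<close> stand for \<open>ran(A\<^sub>0)\<close>, \<open>ran(A\<^sub>1\<^sup>*)\<close>.\<close>

definition inv_a00 :: "'a::complex_hilbert set \<Rightarrow> ('a \<Rightarrow> 'a) \<Rightarrow> 'a \<Rightarrow> 'a" where
  "inv_a00 X0 a = bop_inverse X0 X0 (block X0 X0 a)"

definition a10_inv_a00 :: "'a::complex_hilbert set \<Rightarrow> 'a set \<Rightarrow> ('a \<Rightarrow> 'a) \<Rightarrow> 'a \<Rightarrow> 'a" where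
  "a10_inv_a00 X0 X1 a = compose X0 (block X1 X0 a) (inv_a00 X0 a)"

definition inv_a00_a01 :: "'a::complex_hilbert set \<Rightarrow> 'a set \<Rightarrow> ('a \<Rightarrow> 'a) \<Rightarrow> 'a \<Rightarrow> 'a" where
  "inv_a00_a01 X0 X1 a = compose X1 (inv_a00 X0 a) (block X0 X1 a)"

definition schur_complement :: "'a::complex_hilbert set \<Rightarrow> 'a set \<Rightarrow> ('a \<Rightarrow> 'a) \<Rightarrow> 'a \<Rightarrow> 'a" where
  "schur_complement X0 X1 a =
     (\<lambda>x\<in>X1. block X1 X1 a x - compose X1 (a10_inv_a00 X0 X1 a) (block X0 X1 a) x)"

definition M_set :: "real \<Rightarrow> real \<Rightarrow> ('h0::complex_hilbert \<times> 'h1::complex_hilbert) set \<Rightarrow>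
    ('h1 \<times> 'h2::complex_hilbert) set \<Rightarrow> ('h1 \<Rightarrow> 'h1) set" where
  "M_set \<alpha> \<beta> A0 A1 =
     (let X0 = Range A0; X1 = Range (op_adjoint A1) in
      {a \<in> bounded_ops UNIV UNIV.
        continuously_invertible UNIV UNIV a \<and>
        Re_ge X0 (block X0 X0 a) \<alpha> \<and>
        Re_ge X0 (inv_a00 X0 a) (1 / \<beta>) \<and>
        Re_ge X1 (block X1 X1 (bop_inverse UNIV UNIV a)) (1 / \<beta>) \<and>
        Re_ge X1 (bop_inverse X1 X1 (block X1 X1 (bop_inverse UNIV UNIV a))) \<alpha>})"

definition M1_set :: "real \<Rightarrow> real \<Rightarrow> ('h0::complex_hilbert \<times> 'h1::complex_hilbert) set \<Rightarrow>
    ('h1 \<times> 'h2::complex_hilbert) set \<Rightarrow> ('h1 \<Rightarrow> 'h1) set" where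
  "M1_set \<alpha> \<beta> A0 A1 =
     (let X0 = Range A0; X1 = Range (op_adjoint A1) in
      {a \<in> M_set \<alpha> \<beta> A0 A1.
        onorm_on X1 (inv_a00_a01 X0 X1 a) \<le> \<beta> \<and> onorm_on X0 (a10_inv_a00 X0 X1 a) \<le> \<beta>})"

definition tau_H :: "real \<Rightarrow> real \<Rightarrow> ('h0::complex_hilbert \<times> 'h1::complex_hilbert) set \<Rightarrow>
    ('h1 \<times> 'h2::complex_hilbert) set \<Rightarrow> ('h1 \<Rightarrow> 'h1) topology" where
  "tau_H \<alpha> \<beta> A0 A1 =
     (let X0 = Range A0; X1 = Range (op_adjoint A1) in
      initial_topology (M_set \<alpha> \<beta> A0 A1)
        {(inv_a00 X0, weak_op_topology X0 X0),
         (a10_inv_a00 X0 X1, weak_op_topology X0 X1),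
         (inv_a00_a01 X0 X1, weak_op_topology X1 X0),
         (schur_complement X0 X1, weak_op_topology X1 X1)})"

end

theory Submission
  imports Defs
begin

text \<open>
  Write \<open>X\<^sub>0 = ran(A\<^sub>0)\<close> and \<open>X\<^sub>1 = ran(A\<^sub>1\<^sup>*)\<close>. Block elimination turns an operator \<open>a\<close> into the four
  operators that define the topology, and this change of variables does all the work:
  \<open>a\<close> is determined by \<open>b = a\<^sub>0\<^sub>0\<inverse>\<close>, \<open>c = a\<^sub>1\<^sub>0a\<^sub>0\<^sub>0\<inverse>\<close>, \<open>d = a\<^sub>0\<^sub>0\<inverse>a\<^sub>0\<^sub>1\<close> and the Schur complement
  \<open>s = a\<^sub>1\<^sub>1 - a\<^sub>1\<^sub>0a\<^sub>0\<^sub>0\<inverse>a\<^sub>0\<^sub>1\<close>, and \<open>s\<inverse> = (a\<inverse>)\<^sub>1\<^sub>1\<close>. Hence the four inequalities defining the class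
  constrain only \<open>b\<close> (two of them) and only \<open>s\<close> (the other two), while the two norm bounds
  constrain \<open>c\<close> and \<open>d\<close>. Conversely any admissible quadruple \<open>(b, c, d, s)\<close> is reassembled into an
  operator of the class (\<open>M_class_assembled\<close>). So the set in question is mapped onto a product of
  four sets of operators, and, the topology being initial with respect to that map, it
  is enough that each factor is compact in the weak operator topology
  (\<open>compactin_initial_topology\<close>).

  For \<open>c\<close> and \<open>d\<close> the factor is a norm ball. It corresponds to a set of bounded sesquilinear forms,
  which is closed in a product of discs, hence compact by Tychonoff's theorem; the Riesz
  representation theorem gives the operators back (\<open>compactin_weak_op_topology\<close>). For \<open>b\<close> and \<open>s\<close>
  the factor is given by a lower bound on \<open>Re T\<close> and a lower bound on \<open>Re T\<inverse>\<close>. Inversion is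
  not weakly continuous, but \<open>Re T\<inverse> \<ge> c\<close> means \<open>c \<parallel>Tx\<parallel>\<^sup>2 \<le> Re \<langle>Tx, x\<rangle>\<close>, where the left hand side is
  weakly lower semicontinuous; so the condition is weakly closed, and it bounds
  \<open>\<parallel>T\<parallel>\<close> by \<open>1/c\<close> (\<open>compactin_coercive_ops\<close>). Conversely the lower bound on \<open>Re T\<close> makes \<open>T\<close>
  invertible by the Lax-Milgram theorem.

  Finally \<open>X\<^sub>0\<close> and \<open>X\<^sub>1\<close> have to be orthogonal complements of each other, which is the closed range
  theorem for \<open>A\<^sub>1\<close> (\<open>range_op_adjoint\<close>); it rests on an open mapping argument
  (\<open>bounded_lifts_of_closed_range\<close>).
\<close>

section \<open>Real Hilbert spaces\<close>

text \<open>
  Riesz representation, by minimising \<open>\<parallel>u\<parallel>\<^sup>2 - 2 f(u)\<close> over \<open>U\<close>: the parallelogram identity makes a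
  minimising sequence Cauchy, and the first variation at the minimiser is the claim. Applied
  to \<open>f = \<langle>\<cdot>, h\<rangle>\<close> it also yields orthogonal projections onto \<open>U\<close>.
\<close>

lemma riesz_on_closed_subspace:
  fixes U :: "'a::{real_inner,banach} set" and f :: "'a \<Rightarrow> real"
  assumes U: "subspace U" "closed U"
    and add: "\<And>x y. x \<in> U \<Longrightarrow> y \<in> U \<Longrightarrow> f (x + y) = f x + f y"
    and scale: "\<And>c x. x \<in> U \<Longrightarrow> f (c *\<^sub>R x) = c * f x"
    and bound: "\<And>x. x \<in> U \<Longrightarrow> \<bar>f x\<bar> \<le> K * norm x"
  shows "\<exists>z\<in>U. \<forall>u\<in>U. f u = u \<bullet> z"
proof -
  define q where "q u = (norm u)\<^sup>2 - 2 * f u" for u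
  define m where "m = Inf (q ` U)"
  have U0: "0 \<in> U" using U(1) by (simp add: subspace_0)
  have q_below: "- K\<^sup>2 \<le> q u" if "u \<in> U" for u
  proof -
    have "0 \<le> (norm u - K)\<^sup>2" by simp
    with bound[OF that] show ?thesis
      unfolding q_def by (simp add: power2_eq_square algebra_simps)
  qed
  then have bdd: "bdd_below (q ` U)" by (rule bdd_belowI2)
  have m_le: "m \<le> q u" if "u \<in> U" for u
    unfolding m_def using bdd that by (auto intro: cInf_lower)
  have "\<exists>u\<in>U. q u < m + 1 / real (Suc n)" for n
    using cInf_less_iff[of "q ` U" "m + 1 / real (Suc n)"] bdd U0 unfolding m_def by fastforce
  then obtain w where w: "\<And>n. w n \<in> U" "\<And>n. q (w n) < m + 1 / real (Suc n)" by metis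
  have gap: "(dist (w i) (w j))\<^sup>2 \<le> 2 / real (Suc i) + 2 / real (Suc j)" for i j
  proof -
    let ?h = "(1/2) *\<^sub>R (w i + w j)"
    have "?h \<in> U" using U(1) w(1) by (intro subspace_scale subspace_add) auto
    moreover have "f ?h = (f (w i) + f (w j)) / 2"
      using scale[of "w i + w j" "1/2"] add[of "w i" "w j"] w(1) subspace_add[OF U(1)] by simp
    moreover have "(norm ?h)\<^sup>2 = (norm (w i + w j))\<^sup>2 / 4"
      by (simp add: power_divide)
    ultimately have "(norm (w i + w j))\<^sup>2 / 4 - (f (w i) + f (w j)) \<ge> m"
      using m_le[of ?h] unfolding q_def by simp
    moreover have "(dist (w i) (w j))\<^sup>2 = 2 * (norm (w i))\<^sup>2 + 2 * (norm (w j))\<^sup>2 - (norm (w i + w j))\<^sup>2"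
      unfolding dist_norm power2_norm_eq_inner by (simp add: inner_simps inner_commute)
    ultimately show ?thesis using w(2)[of i] w(2)[of j] unfolding q_def by argo
  qed
  have "Cauchy w"
  proof (rule metric_CauchyI)
    fix e :: real assume e: "e > 0"
    obtain N where N: "4 / e\<^sup>2 < real N" using reals_Archimedean2 by blast
    have Npos: "0 < real (Suc N)" by simp
    have N': "4 / real (Suc N) < e\<^sup>2"
    proof -
      have "4 < e\<^sup>2 * real N" using N e by (simp add: field_simps)
      also have "\<dots> \<le> e\<^sup>2 * real (Suc N)" by (rule mult_left_mono) auto
      finally show ?thesis by (simp add: field_simps)
    qed
    have "dist (w i) (w j) < e" if ij: "i \<ge> N" "j \<ge> N" for i j
    proof -
      have "2 / real (Suc i) \<le> 2 / real (Suc N)" "2 / real (Suc j) \<le> 2 / real (Suc N)"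
        using ij by (auto intro!: divide_left_mono)
      then have "(dist (w i) (w j))\<^sup>2 < e\<^sup>2" using gap[of i j] N' by linarith
      then show ?thesis using e by (simp add: power2_less_imp_less)
    qed
    then show "\<exists>M. \<forall>i\<ge>M. \<forall>j\<ge>M. dist (w i) (w j) < e" by blast
  qed
  then obtain z where z: "w \<longlonglongrightarrow> z" using Cauchy_convergent convergent_def by blast
  have zU: "z \<in> U" using closed_sequentially[OF U(2) _ z] w(1) by auto
  have f_diff: "f (x - y) = f x - f y" if "x \<in> U" "y \<in> U" for x y
    using add[of "x - y" y] that subspace_diff[OF U(1)] by simp
  have "(\<lambda>n. f (w n)) \<longlonglongrightarrow> f z"
  proof (rule LIM_zero_cancel, rule Lim_null_comparison)
    show "\<forall>\<^sub>F n in sequentially. norm (f (w n) - f z) \<le> K * norm (w n - z)"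
      using bound f_diff w(1) zU subspace_diff[OF U(1)] by (metis (mono_tags, lifting) always_eventually real_norm_def)
    show "(\<lambda>n. K * norm (w n - z)) \<longlonglongrightarrow> 0"
      using tendsto_mult_left[OF tendsto_norm[OF LIM_zero[OF z]], of K] by simp
  qed
  then have "(\<lambda>n. q (w n)) \<longlonglongrightarrow> q z"
    unfolding q_def by (intro tendsto_intros z)
  moreover have "(\<lambda>n. m + 1 / real (Suc n)) \<longlonglongrightarrow> m + 0"
    by (intro tendsto_intros LIMSEQ_Suc lim_1_over_n)
  ultimately have qz: "q z \<le> m"
    using w(2) by (intro LIMSEQ_le[of "\<lambda>n. q (w n)"]) (auto intro: less_imp_le)
  have "f u = u \<bullet> z" if u: "u \<in> U" for u
  proof -
    have var: "0 \<le> 2 * t * (u \<bullet> z - f u) + t\<^sup>2 * (norm u)\<^sup>2" for t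
    proof -
      have "z + t *\<^sub>R u \<in> U" using U(1) u zU by (simp add: subspace_add subspace_scale)
      then have "q z \<le> q (z + t *\<^sub>R u)" using m_le qz by force
      moreover have "f (z + t *\<^sub>R u) = f z + t * f u"
        using add[of z "t *\<^sub>R u"] scale[OF u] zU subspace_scale[OF U(1) u] by simp
      moreover have "(norm (z + t *\<^sub>R u))\<^sup>2 = (norm z)\<^sup>2 + 2 * t * (u \<bullet> z) + t\<^sup>2 * (norm u)\<^sup>2"
        unfolding power2_norm_eq_inner
        by (simp add: inner_simps inner_commute power2_eq_square algebra_simps)
      ultimately show ?thesis unfolding q_def by (simp add: algebra_simps)
    qed
    (* The quadratic polynomial in t is minimal near t = - d / |u|^2; adding 1 to |u|^2 avoids
       the case u = 0. *)
    define d where "d = u \<bullet> z - f u"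
    define N where "N = (norm u)\<^sup>2 + 1"
    have N: "N > 0" "(norm u)\<^sup>2 < N" unfolding N_def by (auto intro: add_nonneg_pos)
    have "0 \<le> 2 * (- d / N) * d + (- d / N)\<^sup>2 * (norm u)\<^sup>2" using var[of "- d / N"] unfolding d_def .
    also have "\<dots> \<le> 2 * (- d / N) * d + (- d / N)\<^sup>2 * N"
      using N by (intro add_left_mono mult_left_mono) auto
    also have "\<dots> = - (d\<^sup>2 / N)" using N by (simp add: power2_eq_square field_simps)
    finally have "d\<^sup>2 / N \<le> 0" by simp
    then have "d\<^sup>2 \<le> 0" using N(1) by (simp add: divide_le_0_iff)
    then show ?thesis unfolding d_def by simp
  qed
  then show ?thesis using zU by blast
qed

text \<open>
  Coercivity bounds \<open>T\<close> from below, so its range is complete; a vector orthogonal to the range is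
  killed by coercivity tested against itself, so the range is all of \<open>U\<close>.
\<close>

lemma lax_milgram_on_closed_subspace:
  fixes U :: "'a::{real_inner,banach} set" and T :: "'a \<Rightarrow> 'a"
  assumes U: "subspace U" "closed U" and T: "T ` U \<subseteq> U"
    and add: "\<And>x y. x \<in> U \<Longrightarrow> y \<in> U \<Longrightarrow> T (x + y) = T x + T y"
    and scale: "\<And>c x. x \<in> U \<Longrightarrow> T (c *\<^sub>R x) = c *\<^sub>R T x"
    and bound: "\<And>x. x \<in> U \<Longrightarrow> norm (T x) \<le> K * norm x"
    and c: "c > 0" and coercive: "\<And>x. x \<in> U \<Longrightarrow> c * (norm x)\<^sup>2 \<le> T x \<bullet> x"
  shows "bij_betw T U U" and "\<And>x. x \<in> U \<Longrightarrow> c * norm x \<le> norm (T x)"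
proof -
  show below: "c * norm x \<le> norm (T x)" if "x \<in> U" for x
  proof (cases "x = 0")
    case False
    have "c * (norm x)\<^sup>2 \<le> norm (T x) * norm x"
      using coercive[OF that] norm_cauchy_schwarz[of "T x" x] by linarith
    then show ?thesis using False by (simp add: power2_eq_square)
  qed simp
  have diff: "T (x - y) = T x - T y" if "x \<in> U" "y \<in> U" for x y
    using add[of "x - y" y] that subspace_diff[OF U(1)] by simp
  have "inj_on T U"
  proof (rule inj_onI)
    fix x y assume xy: "x \<in> U" "y \<in> U" "T x = T y"
    then have "c * norm (x - y) \<le> 0" using below[of "x - y"] diff[of x y] subspace_diff[OF U(1)] by simp
    then show "x = y" using c by (simp add: mult_le_0_iff)
  qed
  have range_subspace: "subspace (T ` U)"
  proof (rule subspaceI)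
    have "T 0 = 0" using scale[of 0 0] subspace_0[OF U(1)] by simp
    then show "0 \<in> T ` U" using subspace_0[OF U(1)] by force
    show "x + y \<in> T ` U" if "x \<in> T ` U" "y \<in> T ` U" for x y
      using that add subspace_add[OF U(1)] by (metis (no_types, lifting) image_iff)
    show "r *\<^sub>R x \<in> T ` U" if "x \<in> T ` U" for r x
      using that scale subspace_scale[OF U(1)] by (metis (no_types, lifting) image_iff)
  qed
  have range_closed: "closed (T ` U)"
    unfolding closed_sequential_limits
  proof (intro allI impI, elim conjE)
    fix s l assume s: "\<forall>n. s n \<in> T ` U" "s \<longlonglongrightarrow> l"
    then have "\<forall>n. \<exists>x. x \<in> U \<and> s n = T x" by blast
    then obtain x where x: "\<And>n. x n \<in> U" "\<And>n. s n = T (x n)" by metis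
    have "Cauchy x"
    proof (rule metric_CauchyI)
      fix e :: real assume "e > 0"
      then have "c * e > 0" using c by simp
      then obtain M where M: "\<And>i j. i \<ge> M \<Longrightarrow> j \<ge> M \<Longrightarrow> dist (s i) (s j) < c * e"
        using metric_CauchyD[OF LIMSEQ_imp_Cauchy[OF s(2)]] by meson
      have "c * dist (x i) (x j) \<le> dist (s i) (s j)" for i j
        using below[of "x i - x j"] diff x subspace_diff[OF U(1)] by (simp add: dist_norm)
      then have "dist (x i) (x j) < e" if "i \<ge> M" "j \<ge> M" for i j
        using M[OF that] c by (metis le_less_trans mult_less_cancel_left_pos)
      then show "\<exists>M. \<forall>i\<ge>M. \<forall>j\<ge>M. dist (x i) (x j) < e" by blast
    qed
    then obtain z where z: "x \<longlonglongrightarrow> z" using Cauchy_convergent convergent_def by blast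
    have zU: "z \<in> U" using closed_sequentially[OF U(2) _ z] x(1) by auto
    have "(\<lambda>n. T (x n)) \<longlonglongrightarrow> T z"
    proof (rule LIM_zero_cancel, rule Lim_null_comparison)
      show "\<forall>\<^sub>F n in sequentially. norm (T (x n) - T z) \<le> K * norm (x n - z)"
        using bound diff x(1) zU subspace_diff[OF U(1)] by (metis (mono_tags, lifting) always_eventually)
      show "(\<lambda>n. K * norm (x n - z)) \<longlonglongrightarrow> 0"
        using tendsto_mult_left[OF tendsto_norm[OF LIM_zero[OF z]], of K] by simp
    qed
    then have "l = T z" using s(2) x(2) LIMSEQ_unique by (metis (no_types, lifting) ext)
    then show "l \<in> T ` U" using zU by blast
  qed
  have "U \<subseteq> T ` U"
  proof
    fix y assume y: "y \<in> U"
    have "\<exists>z\<in>T ` U. \<forall>u\<in>T ` U. u \<bullet> y = u \<bullet> z"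
      by (rule riesz_on_closed_subspace[OF range_subspace range_closed, where K = "norm y"])
        (simp_all add: inner_add_left, metis Cauchy_Schwarz_ineq2 mult.commute)
    then obtain z where z: "z \<in> T ` U" "\<And>u. u \<in> T ` U \<Longrightarrow> u \<bullet> y = u \<bullet> z" by blast
    have d: "y - z \<in> U" using y z(1) T subspace_diff[OF U(1)] by blast
    have "c * (norm (y - z))\<^sup>2 \<le> 0"
      using coercive[OF d] z(2)[of "T (y - z)"] d by (simp add: inner_diff_right)
    then have "y = z" using c by (simp add: mult_le_0_iff)
    then show "y \<in> T ` U" using z(1) by simp
  qed
  then show "bij_betw T U U" using \<open>inj_on T U\<close> T by (auto simp: bij_betw_def)
qed

section \<open>The open mapping theorem for closed linear relations\<close>

text \<open>
  The sets of values with a preimage of norm at most \<open>n\<close> exhaust the complete space \<open>Range A\<close>, so by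
  Baire's theorem the closure of one of them has interior points. Differences of its elements
  approximate every small value; hence every \<open>r\<close> has a lift of controlled norm up to an error
  of norm \<open>\<parallel>r\<parallel>/2\<close>. Lifting the successive errors gives a geometric series, whose sum is an exact
  lift because \<open>A\<close> is closed.
\<close>

lemma bounded_lifts_of_closed_range:
  fixes A :: "('a::banach \<times> 'b::banach) set"
  assumes A: "subspace A" "closed A" and R: "closed (Range A)"
  shows "\<exists>K. \<forall>r\<in>Range A. \<exists>x. (x, r) \<in> A \<and> norm x \<le> K * norm r"
proof -
  have A_add: "(x + y, u + v) \<in> A" if "(x, u) \<in> A" "(y, v) \<in> A" for x y u v
    using subspace_add[OF A(1) that] by simp
  have A_scale: "(c *\<^sub>R x, c *\<^sub>R u) \<in> A" if "(x, u) \<in> A" for c x u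
    using subspace_scale[OF A(1) that] by simp
  have A_diff: "(x - y, u - v) \<in> A" if "(x, u) \<in> A" "(y, v) \<in> A" for x y u v
    using subspace_diff[OF A(1) that] by simp
  have A0: "(0, 0) \<in> A" using subspace_0[OF A(1)] by (simp add: zero_prod_def)
  define D where "D n = {r. \<exists>x. (x, r) \<in> A \<and> norm x \<le> real n}" for n :: nat
  let ?X = "top_of_set (Range A)"
  have D_sub: "closure (D n) \<subseteq> Range A" for n
    using R by (intro closure_minimal) (auto simp: D_def)
  have cover: "\<Union> (range (\<lambda>n. closure (D n))) = Range A"
  proof
    show "Range A \<subseteq> \<Union> (range (\<lambda>n. closure (D n)))"
    proof
      fix r assume "r \<in> Range A"
      then obtain x where "(x, r) \<in> A" by blast
      moreover obtain n where "norm x \<le> real n" using real_arch_simple by blast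
      ultimately have "r \<in> D n" unfolding D_def by blast
      then show "r \<in> \<Union> (range (\<lambda>n. closure (D n)))" using closure_subset by blast
    qed
  qed (use D_sub in blast)
  have "\<exists>n. ?X interior_of closure (D n) \<noteq> {}"
  proof (rule ccontr)
    assume no: "\<nexists>n. ?X interior_of closure (D n) \<noteq> {}"
    have "?X interior_of \<Union> (range (\<lambda>n. closure (D n))) = {}"
    proof (rule Baire_category_alt)
      show "completely_metrizable_space ?X \<or> locally_compact_space ?X \<and> regular_space ?X"
        using completely_metrizable_space_closedin[OF completely_metrizable_space_euclidean
            R[unfolded closed_closedin]] by blast
      show "countable (range (\<lambda>n. closure (D n)))" by simp
      show "closedin ?X T \<and> ?X interior_of T = {}" if "T \<in> range (\<lambda>n. closure (D n))" for T
      proof -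
        obtain n where "T = closure (D n)" using \<open>T \<in> _\<close> by blast
        then show ?thesis using no closed_subset[OF D_sub[of n] closed_closure] by simp
      qed
    qed
    moreover have "?X interior_of (Range A) = Range A"
      using interior_of_topspace[of ?X] by simp
    ultimately have "Range A = {}" unfolding cover by simp
    then show False using A0 by blast
  qed
  then obtain n T r0 where T: "openin ?X T" "r0 \<in> T" "T \<subseteq> closure (D n)"
    unfolding interior_of_def by blast
  then obtain e where e: "e > 0" "ball r0 e \<inter> Range A \<subseteq> closure (D n)"
    unfolding openin_contains_ball by (meson order_trans)
  have r0: "r0 \<in> closure (D n)" "r0 \<in> Range A" using T D_sub by auto
  have near_zero: "\<exists>x s. (x, s) \<in> A \<and> norm x \<le> 2 * real n \<and> norm (s - r) < d"
    if r: "r \<in> Range A" "norm r < e" and d: "d > 0" for r d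
  proof -
    have "r0 + r \<in> Range A" using r(1) r0(2) A_add by blast
    then have "r0 + r \<in> closure (D n)" using e(2) r(2) by (auto simp: dist_norm)
    then obtain s where s: "s \<in> D n" "dist s (r0 + r) < d / 2"
      using d closure_approachable half_gt_zero by blast
    obtain t where t: "t \<in> D n" "dist t r0 < d / 2"
      using r0(1) d closure_approachable half_gt_zero by blast
    obtain x y where xy: "(x, s) \<in> A" "norm x \<le> real n" "(y, t) \<in> A" "norm y \<le> real n"
      using s(1) t(1) unfolding D_def by blast
    have "norm (s - t - r) = norm ((s - (r0 + r)) - (t - r0))" by (simp add: algebra_simps)
    also have "\<dots> \<le> norm (s - (r0 + r)) + norm (t - r0)" by (rule norm_triangle_ineq4)
    also have "\<dots> < d" using s(2) t(2) by (simp add: dist_norm)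
    finally show ?thesis
      using A_diff[OF xy(1,3)] xy(2,4) norm_triangle_ineq4[of x y] by (intro exI[of _ "x - y"] exI[of _ "s - t"]) auto
  qed
  define K where "K = 4 * real n / e"
  have K0: "K \<ge> 0" unfolding K_def using e(1) by simp
  have halve: "\<exists>p. p \<in> A \<and> norm (fst p) \<le> K * norm r \<and> norm (r - snd p) \<le> norm r / 2"
    if r: "r \<in> Range A" for r
  proof (cases "r = 0")
    case True
    then show ?thesis using A0 by (intro exI[of _ "(0, 0)"]) simp
  next
    case False
    define t where "t = e / (2 * norm r)"
    have t: "t > 0" unfolding t_def using e(1) False by simp
    have "t *\<^sub>R r \<in> Range A" using r A_scale by blast
    moreover have "norm (t *\<^sub>R r) < e" unfolding t_def using e(1) False by simp
    ultimately obtain x s where xs: "(x, s) \<in> A" "norm x \<le> 2 * real n" "norm (s - t *\<^sub>R r) < e / 4"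
      using near_zero[of "t *\<^sub>R r" "e / 4"] e(1) by auto
    have "norm ((1/t) *\<^sub>R x) \<le> K * norm r"
      using xs(2) t e(1) False unfolding K_def t_def by (simp add: field_simps)
    moreover have "norm (r - (1/t) *\<^sub>R s) \<le> norm r / 2"
    proof -
      have "r - (1/t) *\<^sub>R s = - ((1/t) *\<^sub>R (s - t *\<^sub>R r))" using t by (simp add: scaleR_diff_right)
      then have "norm (r - (1/t) *\<^sub>R s) = (1/t) * norm (s - t *\<^sub>R r)" using t by simp
      also have "\<dots> \<le> (1/t) * (e / 4)" using xs(3) t by (intro mult_left_mono) auto
      also have "\<dots> = norm r / 2" unfolding t_def using e(1) False by (simp add: field_simps)
      finally show ?thesis .
    qed
    ultimately show ?thesis using A_scale[OF xs(1)] by (intro exI[of _ "((1/t) *\<^sub>R x, (1/t) *\<^sub>R s)"]) auto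
  qed
  obtain g where g: "\<And>r. r \<in> Range A \<Longrightarrow> g r \<in> A"
      "\<And>r. r \<in> Range A \<Longrightarrow> norm (fst (g r)) \<le> K * norm r"
      "\<And>r. r \<in> Range A \<Longrightarrow> norm (r - snd (g r)) \<le> norm r / 2"
  proof -
    have "\<exists>g. \<forall>r\<in>Range A. g r \<in> A \<and> norm (fst (g r)) \<le> K * norm r \<and> norm (r - snd (g r)) \<le> norm r / 2"
      using halve by (intro bchoice) blast
    then show ?thesis using that by blast
  qed
  have "\<exists>x. (x, r) \<in> A \<and> norm x \<le> (2 * K) * norm r" if r: "r \<in> Range A" for r
  proof -
    (* The error left after k approximate lifts. *)
    define \<rho> where "\<rho> k = ((\<lambda>s. s - snd (g s)) ^^ k) r" for k
    define x where "x k = fst (g (\<rho> k))" for k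
    have \<rho>0: "\<rho> 0 = r" and \<rho>Suc: "\<rho> (Suc k) = \<rho> k - snd (g (\<rho> k))" for k
      unfolding \<rho>_def by auto
    have \<rho>R: "\<rho> k \<in> Range A" for k
    proof (induction k)
      case (Suc k)
      then obtain y where "(y, \<rho> k) \<in> A" by blast
      moreover have "(fst (g (\<rho> k)), snd (g (\<rho> k))) \<in> A" using g(1)[OF Suc] by simp
      ultimately show ?case unfolding \<rho>Suc using A_diff by blast
    qed (simp add: \<rho>0 r)
    have \<rho>norm: "norm (\<rho> k) \<le> norm r * (1/2) ^ k" for k
    proof (induction k)
      case (Suc k)
      have "norm (\<rho> (Suc k)) \<le> norm (\<rho> k) / 2" unfolding \<rho>Suc by (rule g(3)[OF \<rho>R])
      then show ?case using Suc by simp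
    qed (simp add: \<rho>0)
    have xnorm: "norm (x k) \<le> (K * norm r) * (1/2) ^ k" for k
      using g(2)[OF \<rho>R[of k]] mult_left_mono[OF \<rho>norm[of k] K0] unfolding x_def by (simp add: mult.assoc)
    have geo: "(\<lambda>k. (K * norm r) * (1/2) ^ k) sums ((2 * K) * norm r)"
      using sums_mult[OF geometric_sums[of "1/2::real"], of "K * norm r"] by (simp add: mult_ac)
    have sn: "summable (\<lambda>k. norm (x k))"
      by (rule summable_comparison_test'[OF sums_summable[OF geo], of 0]) (use xnorm in simp)
    have lim: "(\<lambda>k. \<Sum>i<k. x i) \<longlonglongrightarrow> suminf x"
      using summable_LIMSEQ[OF summable_norm_cancel[OF sn]] .
    have partial: "(\<Sum>i<k. x i, r - \<rho> k) \<in> A" for k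
    proof (induction k)
      case (Suc k)
      have "(x k, snd (g (\<rho> k))) \<in> A" unfolding x_def using g(1)[OF \<rho>R] by simp
      moreover have "r - \<rho> (Suc k) = (r - \<rho> k) + snd (g (\<rho> k))" unfolding \<rho>Suc by simp
      ultimately show ?case using A_add[OF Suc] unfolding sum.lessThan_Suc by metis
    qed (simp add: \<rho>0 A0)
    have "(\<lambda>k. (1/2) ^ k :: real) \<longlonglongrightarrow> 0" by (rule LIMSEQ_realpow_zero) auto
    from tendsto_mult_left[OF this, of "norm r"]
    have "(\<lambda>k. norm r * (1/2) ^ k) \<longlonglongrightarrow> 0" by simp
    then have "\<rho> \<longlonglongrightarrow> 0"
      by (rule Lim_null_comparison[rotated]) (use \<rho>norm in simp)
    then have "(\<lambda>k. r - \<rho> k) \<longlonglongrightarrow> r - 0" by (rule tendsto_diff[OF tendsto_const])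
    from tendsto_Pair[OF lim this]
    have "(\<lambda>k. (\<Sum>i<k. x i, r - \<rho> k)) \<longlonglongrightarrow> (suminf x, r)" unfolding diff_zero .
    then have "(suminf x, r) \<in> A" by (rule closed_sequentially[OF A(2) partial])
    moreover have "norm (suminf x) \<le> (2 * K) * norm r"
      using summable_norm[OF sn] suminf_le[OF xnorm sn sums_summable[OF geo]]
      unfolding sums_unique[OF geo, symmetric] by (rule order_trans)
    ultimately show ?thesis by blast
  qed
  then show ?thesis by blast
qed

section \<open>Complex inner product spaces and orthogonal projections\<close>

lemma cinner_zero [simp]: "cinner 0 x = 0" "cinner x 0 = 0"
proof -
  show "cinner 0 x = 0" using cinner_add_left[of 0 0 x] by simp
  then show "cinner x 0 = 0" using cinner_commute[of x 0] by simp
qed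

lemma cinner_add_right: "cinner x (y + z) = cinner x y + cinner x z"
  by (metis cinner_add_left cinner_commute complex_cnj_add)

lemma cinner_scaleC_right: "cinner x (c *\<^sub>C y) = cnj c * cinner x y"
  by (metis cinner_scaleC_left cinner_commute complex_cnj_mult)

lemma cinner_diff_left: "cinner (x - y) z = cinner x z - cinner y z"
  using cinner_add_left[of "x - y" y z] by simp

lemma cinner_diff_right: "cinner x (y - z) = cinner x y - cinner x z"
  using cinner_add_right[of x "y - z" z] by simp

lemma Im_cinner: "Im (cinner x y) = inner x (\<i> *\<^sub>C y)" 
  unfolding Re_cinner[symmetric] by (simp add: cinner_scaleC_right)

lemma cinner_self: "cinner x x = of_real ((norm x)\<^sup>2)"
proof (rule complex_eqI)
  have "Im (cinner x x) = - Im (cinner x x)" using cinner_commute[of x x] by (metis cnj.simps(2))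
  then show "Im (cinner x x) = Im (of_real ((norm x)\<^sup>2))" by simp
qed (simp add: Re_cinner power2_norm_eq_inner)

lemma norm_scaleC [simp]: "norm (c *\<^sub>C x) = cmod c * norm x"
proof -
  have "complex_of_real ((norm (c *\<^sub>C x))\<^sup>2) = c * cnj c * cinner x x"
    unfolding cinner_self[symmetric] by (simp add: cinner_scaleC_left cinner_scaleC_right)
  also have "\<dots> = of_real ((cmod c * norm x)\<^sup>2)"
    unfolding cinner_self complex_norm_square[symmetric] by (simp add: power_mult_distrib)
  finally have "(norm (c *\<^sub>C x))\<^sup>2 = (cmod c * norm x)\<^sup>2" using of_real_eq_iff by blast
  then show ?thesis by (simp add: power2_eq_iff_nonneg)
qed

lemma cinner_Cauchy_Schwarz: "cmod (cinner x y) \<le> norm x * norm y"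
proof -
  define c where "c = cnj (sgn (cinner x y))"
  have "cmod c \<le> 1" unfolding c_def by (simp add: norm_sgn)
  have "c * cinner x y = of_real (cmod (cinner x y))"
    unfolding c_def sgn_eq by (simp add: complex_norm_square[symmetric] power2_eq_square mult.commute)
  then have "cmod (cinner x y) = inner (c *\<^sub>C x) y"
    unfolding Re_cinner[symmetric] cinner_scaleC_left by simp
  also have "\<dots> \<le> (cmod c * norm x) * norm y" using norm_cauchy_schwarz[of "c *\<^sub>C x" y] by simp
  also have "\<dots> \<le> norm x * norm y"
    using \<open>cmod c \<le> 1\<close> by (intro mult_right_mono mult_left_le_one_le) auto
  finally show ?thesis .
qed

lemma scaleC_diff_right: "c *\<^sub>C (x - y) = c *\<^sub>C x - c *\<^sub>C y"
  using scaleC_add_right[of c "x - y" y] by (simp add: algebra_simps)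

definition closed_csubspace :: "'a::complex_hilbert set \<Rightarrow> bool" where
  "closed_csubspace U \<longleftrightarrow> closed U \<and> subspace U \<and> (\<forall>c. \<forall>x\<in>U. c *\<^sub>C x \<in> U)"

definition orth_compl :: "'a::complex_hilbert set \<Rightarrow> 'a set" where
  "orth_compl U = {y. \<forall>x\<in>U. cinner x y = 0}"

lemma closed_csubspaceD:
  assumes "closed_csubspace U"
  shows "closed U" "subspace U" "0 \<in> U"
    and "\<And>x y. x \<in> U \<Longrightarrow> y \<in> U \<Longrightarrow> x + y \<in> U"
    and "\<And>x y. x \<in> U \<Longrightarrow> y \<in> U \<Longrightarrow> x - y \<in> U"
    and "\<And>x. x \<in> U \<Longrightarrow> - x \<in> U"
    and "\<And>c x. x \<in> U \<Longrightarrow> c *\<^sub>C x \<in> U"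
  using assms unfolding closed_csubspace_def
  by (auto intro: subspace_0 subspace_add subspace_diff subspace_neg)

text \<open>
  On a set closed under multiplication by \<open>\<i>\<close> the real part of the inner product determines the
  imaginary part. Representing vectors found with the real theorem are therefore correct for the complex form too.
\<close>

lemma cinner_eq_if_inner_eq:
  assumes "\<And>c x. x \<in> U \<Longrightarrow> c *\<^sub>C x \<in> U" "\<And>x. x \<in> U \<Longrightarrow> inner x y = inner x z" "x \<in> U"
  shows "cinner x y = cinner x z"
proof (rule complex_eqI)
  show "Re (cinner x y) = Re (cinner x z)" unfolding Re_cinner using assms by blast
  have "Im (cinner x w) = - inner (\<i> *\<^sub>C x) w" for w
    unfolding Re_cinner[symmetric] by (simp add: cinner_scaleC_left)
  then show "Im (cinner x y) = Im (cinner x z)" using assms by metis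
qed

lemma closed_csubspace_orth_compl: "closed_csubspace (orth_compl U)"
proof -
  have "orth_compl U = (\<Inter>x\<in>U. {y. inner x y = 0} \<inter> {y. inner (\<i> *\<^sub>C x) y = 0})"
    unfolding orth_compl_def complex_eq_iff Re_cinner[symmetric] by (auto simp: cinner_scaleC_left)
  then have "closed (orth_compl U)" by (simp add: closed_hyperplane closed_INT closed_Int)
  moreover have "subspace (orth_compl U)"
    unfolding subspace_def orth_compl_def
    by (auto simp: cinner_add_right cinner_scaleC_right scaleC_of_real[symmetric])
  ultimately show ?thesis
    unfolding closed_csubspace_def orth_compl_def by (auto simp: cinner_scaleC_right)
qed

text \<open>
  The adjoint of the embedding of \<open>U\<close>, which occurs in the blocks of an operator, is the orthogonal
  projection onto \<open>U\<close>.
\<close>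

definition proj :: "'a::complex_hilbert set \<Rightarrow> 'a \<Rightarrow> 'a" where
  "proj U = bop_adjoint U UNIV (embedding U)"

lemma ex1_orthogonal_projection:
  assumes U: "closed_csubspace U"
  shows "\<exists>!x. x \<in> U \<and> (\<forall>u\<in>U. cinner u h = cinner u x)"
proof -
  note [simp] = closed_csubspaceD[OF U]
  have "\<exists>z\<in>U. \<forall>u\<in>U. inner u h = inner u z"
    by (rule riesz_on_closed_subspace[where K = "norm h"])
      (simp_all add: inner_add_left, metis Cauchy_Schwarz_ineq2 mult.commute)
  then obtain z where z: "z \<in> U" "\<And>u. u \<in> U \<Longrightarrow> inner u h = inner u z" by blast
  show ?thesis
  proof (rule ex1I[of _ z])
    show "z \<in> U \<and> (\<forall>u\<in>U. cinner u h = cinner u z)"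
      using z cinner_eq_if_inner_eq[of U h z] by simp
    fix x assume x: "x \<in> U \<and> (\<forall>u\<in>U. cinner u h = cinner u x)"
    then have d: "x - z \<in> U" using z(1) by simp
    with x have "inner (x - z) h = inner (x - z) x" by (metis Re_cinner)
    with z(2)[OF d] have "inner (x - z) (x - z) = 0" by (simp add: inner_diff_right)
    then show "x = z" by simp
  qed
qed

lemma proj_eq_The: "proj U h = (THE x. x \<in> U \<and> (\<forall>u\<in>U. cinner u h = cinner u x))"
  unfolding proj_def bop_adjoint_def by (simp add: embedding_def)

lemma
  assumes "closed_csubspace U"
  shows proj_in: "proj U h \<in> U"
    and cinner_proj: "u \<in> U \<Longrightarrow> cinner u (proj U h) = cinner u h"
proof -
  have "proj U h \<in> U \<and> (\<forall>u\<in>U. cinner u h = cinner u (proj U h))"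
    unfolding proj_eq_The by (rule theI'[OF ex1_orthogonal_projection[OF assms]])
  then show "proj U h \<in> U" "u \<in> U \<Longrightarrow> cinner u (proj U h) = cinner u h" by simp_all
qed

lemma proj_unique:
  assumes "closed_csubspace U" "x \<in> U" "\<And>u. u \<in> U \<Longrightarrow> cinner u h = cinner u x"
  shows "proj U h = x"
  unfolding proj_eq_The using assms by (intro the1_equality ex1_orthogonal_projection) auto

text \<open>
  The closed range theorem. For \<open>y\<close> orthogonal to the kernel, \<open>Ax \<mapsto> \<langle>x, y\<rangle>\<close> is a well defined
  functional on \<open>Range A\<close>; it is bounded because values have lifts of controlled norm. A Riesz
  representative \<open>z\<close> of it satisfies \<open>A\<^sup>* z = y\<close>.
\<close>

lemma range_op_adjoint:
  fixes A :: "('a::complex_hilbert \<times> 'b::complex_hilbert) set"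
  assumes lin: "linear_operator A" and A: "closed A" "closed (Range A)"
  shows "Range (op_adjoint A) = orth_compl (op_kernel A)"
proof
  show "Range (op_adjoint A) \<subseteq> orth_compl (op_kernel A)"
  proof
    fix y assume "y \<in> Range (op_adjoint A)"
    then obtain z where "(z, y) \<in> op_adjoint A" by blast
    then have "cinner w z = cinner x y" if "(x, w) \<in> A" for x w
      using that unfolding op_adjoint_def by blast
    then show "y \<in> orth_compl (op_kernel A)" unfolding orth_compl_def op_kernel_def by force
  qed
next
  have A_scale: "(c *\<^sub>C x, c *\<^sub>C u) \<in> A" if "(x, u) \<in> A" for c x u
    using lin that unfolding linear_operator_def by blast
  have A_add: "(x + y, u + v) \<in> A" if "(x, u) \<in> A" "(y, v) \<in> A" for x y u v
    using lin that unfolding linear_operator_def by blast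
  have A_scaleR: "(c *\<^sub>R x, c *\<^sub>R u) \<in> A" if "(x, u) \<in> A" for c x u
    using A_scale[OF that, of "of_real c"] by (simp add: scaleC_of_real)
  have A0: "(0, 0) \<in> A" using lin unfolding linear_operator_def by blast
  have sub: "subspace A"
    unfolding subspace_def using A_add A_scaleR A0 by (auto simp: zero_prod_def)
  have subR: "subspace (Range A)"
    unfolding subspace_def using A_add A_scaleR A0 by blast
  obtain K where K: "\<And>r. r \<in> Range A \<Longrightarrow> \<exists>x. (x, r) \<in> A \<and> norm x \<le> K * norm r"
    using bounded_lifts_of_closed_range[OF sub A] by blast
  show "orth_compl (op_kernel A) \<subseteq> Range (op_adjoint A)"
  proof
    fix y assume y: "y \<in> orth_compl (op_kernel A)"
    have well: "inner x y = inner x' y" if "(x, r) \<in> A" "(x', r) \<in> A" for x x' r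
    proof -
      have "(x - x', 0) \<in> A"
        using A_add[OF that(1) A_scaleR[OF that(2), of "-1"]] by simp
      then have "cinner (x - x') y = 0" using y unfolding orth_compl_def op_kernel_def by blast
      then show ?thesis by (metis Re_cinner cinner_diff_left eq_iff_diff_eq_0)
    qed
    define f where "f r = inner (SOME x. (x, r) \<in> A) y" for r
    have f: "f r = inner x y" if "(x, r) \<in> A" for x r
      unfolding f_def using that by (intro well[of _ r]) (auto intro: someI)
    have "\<exists>z\<in>Range A. \<forall>r\<in>Range A. f r = inner r z"
    proof (rule riesz_on_closed_subspace[OF subR A(2)])
      show "f (r + s) = f r + f s" if rs: "r \<in> Range A" "s \<in> Range A" for r s
      proof -
        obtain x x' where "(x, r) \<in> A" "(x', s) \<in> A" using rs by blast
        then show ?thesis using f A_add by (metis inner_add_left)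
      qed
      show "f (c *\<^sub>R r) = c * f r" if "r \<in> Range A" for c r
        using that f A_scaleR by (metis RangeE inner_scaleR_left)
      show "\<bar>f r\<bar> \<le> (K * norm y) * norm r" if r: "r \<in> Range A" for r
      proof -
        obtain x where x: "(x, r) \<in> A" "norm x \<le> K * norm r" using K[OF r] by blast
        have "\<bar>f r\<bar> \<le> norm x * norm y" unfolding f[OF x(1)] by (rule Cauchy_Schwarz_ineq2)
        also have "\<dots> \<le> (K * norm r) * norm y" using x(2) by (intro mult_right_mono) auto
        finally show ?thesis by (simp add: mult_ac)
      qed
    qed
    then obtain z where z: "\<And>x r. (x, r) \<in> A \<Longrightarrow> inner x y = inner r z" using f by (metis Range.intros)
    have "cinner r z = cinner x y" if xr: "(x, r) \<in> A" for x r
    proof (rule complex_eqI)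
      show "Re (cinner r z) = Re (cinner x y)" unfolding Re_cinner using z[OF xr] by simp
      show "Im (cinner r z) = Im (cinner x y)"
        using z[OF A_scale[OF xr, of \<i>]] unfolding Re_cinner[symmetric] by (simp add: cinner_scaleC_left)
    qed
    then have "(z, y) \<in> op_adjoint A" unfolding op_adjoint_def by blast
    then show "y \<in> Range (op_adjoint A)" by blast
  qed
qed

lemma closed_csubspace_Range:
  assumes lin: "linear_operator A" and "closed (Range A)"
  shows "closed_csubspace (Range A)"
proof -
  have "\<forall>c. \<forall>x\<in>Range A. c *\<^sub>C x \<in> Range A" using lin unfolding linear_operator_def by blast
  moreover from this have "\<forall>c. \<forall>x\<in>Range A. c *\<^sub>R x \<in> Range A" by (metis scaleC_of_real)
  moreover have "0 \<in> Range A" "\<forall>x\<in>Range A. \<forall>y\<in>Range A. x + y \<in> Range A"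
    using lin unfolding linear_operator_def by blast+
  ultimately show ?thesis
    using assms(2) unfolding closed_csubspace_def subspace_def by blast
qed

section \<open>Compactness in initial topologies\<close>

lemma topspace_initial_topology [simp]: "topspace (initial_topology S F) = S"
  unfolding initial_topology_def topology_generated_by_topspace by auto

lemma continuous_map_into_initial_topology:
  assumes "\<And>z. z \<in> topspace Z \<Longrightarrow> g z \<in> S"
    and "\<And>f X. (f, X) \<in> F \<Longrightarrow> continuous_map Z X (\<lambda>z. f (g z))"
  shows "continuous_map Z (initial_topology S F) g"
  unfolding initial_topology_def
proof (rule continuous_on_generated_topo)
  fix U assume "U \<in> insert S {{a \<in> S. f a \<in> W} | f X W. (f, X) \<in> F \<and> openin X W}"
  then consider "U = S" | f X W where "U = {a \<in> S. f a \<in> W}" "(f, X) \<in> F" "openin X W" by blast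
  then show "openin Z (g -` U \<inter> topspace Z)"
  proof cases
    case 1
    then have "g -` U \<inter> topspace Z = topspace Z" using assms(1) by blast
    then show ?thesis by simp
  next
    case 2
    then have "g -` U \<inter> topspace Z = {z \<in> topspace Z. f (g z) \<in> W}" using assms(1) by blast
    then show ?thesis using openin_continuous_map_preimage[OF assms(2) 2(3)] 2(2) by simp
  qed
qed (use assms(1) in blast)

lemma compactin_pullback_topology:
  assumes "K \<subseteq> S" "compactin Y (\<Phi> ` K)"
  shows "compactin (pullback_topology S \<Phi> Y) K"
  unfolding compactin_def
proof (intro conjI allI impI)
  show "K \<subseteq> topspace (pullback_topology S \<Phi> Y)"
    using assms compactin_subset_topspace[OF assms(2)] unfolding topspace_pullback_topology by blast
  fix \<U> assume \<U>: "Ball \<U> (openin (pullback_topology S \<Phi> Y)) \<and> K \<subseteq> \<Union> \<U>"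
  define \<V> where "\<V> = {V. openin Y V \<and> \<Phi> -` V \<inter> S \<in> \<U>}"
  have "\<Phi> ` K \<subseteq> \<Union> \<V>"
  proof
    fix w assume "w \<in> \<Phi> ` K"
    then obtain k U where k: "k \<in> K" "w = \<Phi> k" "U \<in> \<U>" "k \<in> U" using \<U> by blast
    then obtain V where "openin Y V" "U = \<Phi> -` V \<inter> S"
      using \<U> unfolding openin_pullback_topology by blast
    then show "w \<in> \<Union> \<V>" using k unfolding \<V>_def by blast
  qed
  moreover have "Ball \<V> (openin Y)" unfolding \<V>_def by blast
  ultimately obtain \<G> where \<G>: "finite \<G>" "\<G> \<subseteq> \<V>" "\<Phi> ` K \<subseteq> \<Union> \<G>"
    using assms(2) unfolding compactin_def by meson
  show "\<exists>\<F>. finite \<F> \<and> \<F> \<subseteq> \<U> \<and> K \<subseteq> \<Union> \<F>"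
  proof (intro exI conjI)
    show "finite ((\<lambda>V. \<Phi> -` V \<inter> S) ` \<G>)" using \<G>(1) by simp
    show "(\<lambda>V. \<Phi> -` V \<inter> S) ` \<G> \<subseteq> \<U>" using \<G>(2) unfolding \<V>_def by blast
    show "K \<subseteq> \<Union> ((\<lambda>V. \<Phi> -` V \<inter> S) ` \<G>)" using \<G>(3) assms(1) by blast
  qed
qed

text \<open>
  If all maps in \<open>F\<close> factor through \<open>\<Phi>\<close>, the initial topology is coarser than the pullback of \<open>Y\<close> along
  \<open>\<Phi>\<close>; and a set is compact in a pullback topology as soon as its image is compact.
\<close>

lemma compactin_initial_topology:
  assumes K: "K \<subseteq> S" "compactin Y (\<Phi> ` K)"
    and F: "\<And>f X. (f, X) \<in> F \<Longrightarrow> \<exists>g. continuous_map Y X g \<and> (\<forall>a\<in>S. f a = g (\<Phi> a))"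
  shows "compactin (initial_topology S F) K"
proof -
  let ?Z = "pullback_topology S \<Phi> Y"
  have "continuous_map ?Z (initial_topology S F) (\<lambda>a. a)"
  proof (rule continuous_map_into_initial_topology)
    fix f X assume "(f, X) \<in> F"
    then obtain g where g: "continuous_map Y X g" "\<And>a. a \<in> S \<Longrightarrow> f a = g (\<Phi> a)" using F by blast
    show "continuous_map ?Z X f"
      using continuous_map_pullback[OF g(1), of S \<Phi>]
      by (rule continuous_map_eq) (simp add: topspace_pullback_topology g(2))
  qed (simp add: topspace_pullback_topology)
  from image_compactin[OF compactin_pullback_topology[OF K] this] show ?thesis by simp
qed

text \<open>
  Tychonoff's theorem in the form needed for functions of two variables, where it is applied
  twice.
\<close>

lemma compact_dependent_functions:
  fixes S :: "'i \<Rightarrow> 'a::topological_space set"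
  assumes "\<And>i. compact (S i)"
  shows "compact {f. \<forall>i. f i \<in> S i}"
proof -
  have "compactin (product_topology (\<lambda>_. euclidean) UNIV) (PiE UNIV S)"
    unfolding compactin_PiE using assms by simp
  moreover have "PiE UNIV S = {f. \<forall>i. f i \<in> S i}" by (auto simp: PiE_def Pi_def)
  ultimately show ?thesis by (simp add: euclidean_product_topology)
qed

lemma continuous_on_evaluate2 [continuous_intros]:
  "continuous_on UNIV (\<lambda>\<phi>::'a \<Rightarrow> 'b \<Rightarrow> 'c::topological_space. \<phi> x y)"
  by (rule continuous_on_compose2[OF continuous_on_product_coordinates continuous_on_product_coordinates]) simp

section \<open>Weak operator compactness\<close>

lemma bounded_opsD:
  assumes "T \<in> bounded_ops U V"
  shows "\<And>x. x \<in> U \<Longrightarrow> T x \<in> V" and "\<And>x. x \<notin> U \<Longrightarrow> T x = undefined"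
    and "\<And>x y. x \<in> U \<Longrightarrow> y \<in> U \<Longrightarrow> T (x + y) = T x + T y"
    and "\<And>c x. x \<in> U \<Longrightarrow> T (c *\<^sub>C x) = c *\<^sub>C T x"
    and "\<exists>K\<ge>0. \<forall>x\<in>U. norm (T x) \<le> K * norm x"
proof -
  show "\<And>x. x \<in> U \<Longrightarrow> T x \<in> V" and "\<And>x. x \<notin> U \<Longrightarrow> T x = undefined"
    and "\<And>x y. x \<in> U \<Longrightarrow> y \<in> U \<Longrightarrow> T (x + y) = T x + T y"
    and "\<And>c x. x \<in> U \<Longrightarrow> T (c *\<^sub>C x) = c *\<^sub>C T x"
    using assms unfolding bounded_ops_def by (auto intro: PiE_mem PiE_arb)
  obtain K where K: "\<And>x. x \<in> U \<Longrightarrow> norm (T x) \<le> K * norm x"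
    using assms unfolding bounded_ops_def by blast
  have "norm (T x) \<le> max K 0 * norm x" if "x \<in> U" for x
    using K[OF that] mult_right_mono[of K "max K 0" "norm x"] by simp
  then show "\<exists>K\<ge>0. \<forall>x\<in>U. norm (T x) \<le> K * norm x" by (intro exI[of _ "max K 0"]) simp
qed

lemma bounded_opsI:
  assumes "\<And>x. x \<in> U \<Longrightarrow> T x \<in> V" and "\<And>x. x \<notin> U \<Longrightarrow> T x = undefined"
    and "\<And>x y. x \<in> U \<Longrightarrow> y \<in> U \<Longrightarrow> T (x + y) = T x + T y"
    and "\<And>c x. x \<in> U \<Longrightarrow> T (c *\<^sub>C x) = c *\<^sub>C T x"
    and "\<And>x. x \<in> U \<Longrightarrow> norm (T x) \<le> K * norm x"
  shows "T \<in> bounded_ops U V"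
proof -
  have "T \<in> U \<rightarrow>\<^sub>E V" using assms(1,2) by (rule PiE_I)
  moreover have "\<exists>K. \<forall>x\<in>U. norm (T x) \<le> K * norm x" using assms(5) by blast
  ultimately show ?thesis unfolding bounded_ops_def using assms(3,4) by simp
qed

lemma eq_if_cinner_eq:
  assumes "closed_csubspace V" "u \<in> V" "v \<in> V" "\<And>y. y \<in> V \<Longrightarrow> cinner u y = cinner v y"
  shows "u = v"
proof -
  have "cinner (u - v) (u - v) = 0"
    using assms(4)[of "u - v"] closed_csubspaceD(5)[OF assms(1-3)] by (simp add: cinner_diff_left)
  then show ?thesis by (simp add: cinner_self)
qed

lemma form_represented:
  assumes V: "closed_csubspace V"
    and add: "\<And>y z. y \<in> V \<Longrightarrow> z \<in> V \<Longrightarrow> f (y + z) = f y + f z"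
    and scale: "\<And>c y. y \<in> V \<Longrightarrow> f (c *\<^sub>C y) = cnj c * f y"
    and bound: "\<And>y. y \<in> V \<Longrightarrow> cmod (f y) \<le> K * norm y" and K: "0 \<le> K"
  shows "\<exists>z\<in>V. (\<forall>y\<in>V. cinner z y = f y) \<and> norm z \<le> K"
proof -
  have "\<exists>z\<in>V. \<forall>y\<in>V. Re (f y) = inner y z"
  proof (rule riesz_on_closed_subspace[where K = K])
    show "Re (f (c *\<^sub>R y)) = c * Re (f y)" if "y \<in> V" for c y
      using scale[OF that, of "of_real c"] by (simp add: scaleC_of_real)
    show "\<bar>Re (f y)\<bar> \<le> K * norm y" if "y \<in> V" for y
      using bound[OF that] abs_Re_le_cmod order_trans by blast
  qed (use closed_csubspaceD[OF V] add in auto)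
  then obtain z where z: "z \<in> V" "\<And>y. y \<in> V \<Longrightarrow> Re (f y) = inner y z" by blast
  have eq: "cinner z y = f y" if y: "y \<in> V" for y
  proof (rule complex_eqI)
    show "Re (cinner z y) = Re (f y)" unfolding Re_cinner using z(2)[OF y] by (simp add: inner_commute)
    have "Im (cinner z y) = Re (f (\<i> *\<^sub>C y))"
      unfolding Im_cinner using z(2)[of "\<i> *\<^sub>C y"] closed_csubspaceD(7)[OF V y] by (simp add: inner_commute)
    then show "Im (cinner z y) = Im (f y)" using scale[OF y, of \<i>] by simp
  qed
  have "(norm z)\<^sup>2 = cmod (cinner z z)" unfolding cinner_self norm_of_real by simp
  also have "\<dots> \<le> K * norm z" using eq[OF z(1)] bound[OF z(1)] by simp
  finally have sq: "norm z * norm z \<le> K * norm z" by (simp add: power2_eq_square)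
  then have "norm z \<le> K" using K by (cases "z = 0") auto
  then show ?thesis using z(1) eq by blast
qed


definition op_ball :: "'a::complex_hilbert set \<Rightarrow> 'b::complex_hilbert set \<Rightarrow> real \<Rightarrow> ('a \<Rightarrow> 'b) set" where
  "op_ball U V K = {T \<in> bounded_ops U V. \<forall>x\<in>U. norm (T x) \<le> K * norm x}"

text \<open>
  The value 0 off \<open>U \<times> V\<close> makes forms total functions, so that the topology of pointwise
  convergence is the one of the function type.
\<close>

definition op_form ::
  "'a::complex_hilbert set \<Rightarrow> 'b::complex_hilbert set \<Rightarrow> ('a \<Rightarrow> 'b) \<Rightarrow> 'a \<Rightarrow> 'b \<Rightarrow> complex" where
  "op_form U V T = (\<lambda>x y. if x \<in> U \<and> y \<in> V then cinner (T x) y else 0)"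

text \<open>
  All conditions are equations or non-strict inequalities between finitely many values of \<open>\<phi>\<close>,
  hence closed under pointwise convergence.
\<close>

definition bounded_forms ::
  "'a::complex_hilbert set \<Rightarrow> 'b::complex_hilbert set \<Rightarrow> real \<Rightarrow> ('a \<Rightarrow> 'b \<Rightarrow> complex) set" where
  "bounded_forms U V K = {\<phi>.
     (\<forall>x y. cmod (\<phi> x y) \<le> (if x \<in> U \<and> y \<in> V then K * norm x * norm y else 0)) \<and>
     (\<forall>x x' y. x \<in> U \<longrightarrow> x' \<in> U \<longrightarrow> y \<in> V \<longrightarrow> \<phi> (x + x') y = \<phi> x y + \<phi> x' y) \<and>
     (\<forall>c x y. x \<in> U \<longrightarrow> y \<in> V \<longrightarrow> \<phi> (c *\<^sub>C x) y = c * \<phi> x y) \<and>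
     (\<forall>x y y'. x \<in> U \<longrightarrow> y \<in> V \<longrightarrow> y' \<in> V \<longrightarrow> \<phi> x (y + y') = \<phi> x y + \<phi> x y') \<and>
     (\<forall>c x y. x \<in> U \<longrightarrow> y \<in> V \<longrightarrow> \<phi> x (c *\<^sub>C y) = cnj c * \<phi> x y)}"

lemma compact_bounded_forms: "compact (bounded_forms U V K)"
proof -
  define B where "B x y = (if x \<in> U \<and> y \<in> V then K * norm x * norm y else 0)" for x y
  have "compact {\<phi>. \<forall>x. \<phi> x \<in> {\<psi>. \<forall>y. \<psi> y \<in> cball (0::complex) (B x y)}}"
    by (intro compact_dependent_functions compact_cball)
  then have "compact {\<phi>. \<forall>x y. cmod (\<phi> x y) \<le> B x y}" by simp
  moreover have "closed {\<phi> :: 'a \<Rightarrow> 'b \<Rightarrow> complex.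
     (\<forall>x x' y. x \<in> U \<longrightarrow> x' \<in> U \<longrightarrow> y \<in> V \<longrightarrow> \<phi> (x + x') y = \<phi> x y + \<phi> x' y) \<and>
     (\<forall>c x y. x \<in> U \<longrightarrow> y \<in> V \<longrightarrow> \<phi> (c *\<^sub>C x) y = c * \<phi> x y) \<and>
     (\<forall>x y y'. x \<in> U \<longrightarrow> y \<in> V \<longrightarrow> y' \<in> V \<longrightarrow> \<phi> x (y + y') = \<phi> x y + \<phi> x y') \<and>
     (\<forall>c x y. x \<in> U \<longrightarrow> y \<in> V \<longrightarrow> \<phi> x (c *\<^sub>C y) = cnj c * \<phi> x y)}"
    by (intro closed_Collect_conj closed_Collect_all closed_Collect_imp open_Collect_const
        closed_Collect_eq continuous_intros)
  ultimately show ?thesis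
    unfolding bounded_forms_def B_def[symmetric] by (subst Collect_conj_eq) (rule compact_Int_closed)
qed

lemma op_form_in_bounded_forms:
  assumes "closed_csubspace U" "closed_csubspace V" "T \<in> op_ball U V K"
  shows "op_form U V T \<in> bounded_forms U V K"
proof -
  have T: "T \<in> bounded_ops U V" "\<And>x. x \<in> U \<Longrightarrow> norm (T x) \<le> K * norm x"
    using assms(3) unfolding op_ball_def by auto
  note [simp] = closed_csubspaceD(4,7)[OF assms(1)] closed_csubspaceD(4,7)[OF assms(2)] bounded_opsD(3,4)[OF T(1)]
  have "cmod (cinner (T x) y) \<le> K * norm x * norm y" if "x \<in> U" for x y
    using cinner_Cauchy_Schwarz[of "T x" y] mult_right_mono[OF T(2)[OF that], of "norm y"] by simp
  then show ?thesis
    unfolding bounded_forms_def op_form_def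
    by (auto simp: cinner_add_left cinner_add_right cinner_scaleC_left cinner_scaleC_right)
qed

lemma bounded_form_is_op_form:
  assumes U: "closed_csubspace U" and V: "closed_csubspace V" and K: "0 \<le> K"
    and \<phi>: "\<phi> \<in> bounded_forms U V K"
  shows "\<exists>T\<in>op_ball U V K. op_form U V T = \<phi>"
proof -
  have b: "cmod (\<phi> x y) \<le> (if x \<in> U \<and> y \<in> V then K * norm x * norm y else 0)" for x y
    using \<phi> unfolding bounded_forms_def by blast
  have "\<exists>z\<in>V. (\<forall>y\<in>V. cinner z y = \<phi> x y) \<and> norm z \<le> K * norm x" if x: "x \<in> U" for x
  proof (rule form_represented[OF V])
    show "cmod (\<phi> x y) \<le> K * norm x * norm y" if "y \<in> V" for y using b[of x y] x that by simp
  qed (use \<phi> x K in \<open>auto simp: bounded_forms_def\<close>)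
  then obtain t where t: "\<And>x. x \<in> U \<Longrightarrow> t x \<in> V" "\<And>x. x \<in> U \<Longrightarrow> norm (t x) \<le> K * norm x"
      "\<And>x y. x \<in> U \<Longrightarrow> y \<in> V \<Longrightarrow> cinner (t x) y = \<phi> x y"
    by metis
  note [simp] = closed_csubspaceD(4,7)[OF U] closed_csubspaceD(4,7)[OF V] t
  have "restrict t U \<in> bounded_ops U V"
  proof (rule bounded_opsI[where K = K])
    show "restrict t U (x + x') = restrict t U x + restrict t U x'" if "x \<in> U" "x' \<in> U" for x x'
      using that \<phi> by (intro eq_if_cinner_eq[OF V]) (auto simp: bounded_forms_def cinner_add_left)
    show "restrict t U (c *\<^sub>C x) = c *\<^sub>C restrict t U x" if "x \<in> U" for c x
      using that \<phi> by (intro eq_if_cinner_eq[OF V]) (auto simp: bounded_forms_def cinner_scaleC_left)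
  qed auto
  then have "restrict t U \<in> op_ball U V K" unfolding op_ball_def by simp
  moreover have "op_form U V (restrict t U) = \<phi>"
  proof (intro ext)
    show "op_form U V (restrict t U) x y = \<phi> x y" for x y
      using b[of x y] unfolding op_form_def by auto
  qed
  ultimately show ?thesis by blast
qed

text \<open>
  The weak operator topology is the topology of pointwise convergence of the forms
  \<open>\<langle>Tx, y\<rangle>\<close>, and the forms of the operators of norm at most \<open>K\<close> are exactly the forms bounded by
  \<open>K\<close>. The closed set \<open>C\<close> allows for further weakly closed conditions.
\<close>

lemma compactin_weak_op_topology:
  assumes U: "closed_csubspace U" and V: "closed_csubspace V" and K: "0 \<le> K" and C: "closed C"
  shows "compactin (weak_op_topology U V) {T \<in> op_ball U V K. op_form U V T \<in> C}"
  unfolding weak_op_topology_def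
proof (rule compactin_initial_topology[where Y = euclidean and \<Phi> = "op_form U V"])
  show "{T \<in> op_ball U V K. op_form U V T \<in> C} \<subseteq> bounded_ops U V" unfolding op_ball_def by blast
  have "op_form U V ` {T \<in> op_ball U V K. op_form U V T \<in> C} = bounded_forms U V K \<inter> C"
    using op_form_in_bounded_forms[OF U V] bounded_form_is_op_form[OF U V K] by fast
  then show "compactin euclidean (op_form U V ` {T \<in> op_ball U V K. op_form U V T \<in> C})"
    using compact_Int_closed[OF compact_bounded_forms C] by simp
  fix f and X :: "complex topology"
  assume "(f, X) \<in> {(\<lambda>T. cinner (T x) y, euclidean) | x y. x \<in> U \<and> y \<in> V}"
  then obtain x y where f: "f = (\<lambda>T. cinner (T x) y)" "X = euclidean" "x \<in> U" "y \<in> V" by blast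
  have "continuous_map euclidean X (\<lambda>\<phi>::'a \<Rightarrow> 'b \<Rightarrow> complex. \<phi> x y)"
    unfolding f(2) by (simp add: continuous_on_evaluate2)
  moreover have "\<forall>T\<in>bounded_ops U V. f T = op_form U V T x y" unfolding f(1) op_form_def using f(3,4) by simp
  ultimately show "\<exists>g. continuous_map euclidean X g \<and> (\<forall>T\<in>bounded_ops U V. f T = g (op_form U V T))" by blast
qed

lemma compactin_op_ball:
  assumes "closed_csubspace U" "closed_csubspace V" "0 \<le> K"
  shows "compactin (weak_op_topology U V) (op_ball U V K)"
  using compactin_weak_op_topology[OF assms closed_UNIV] by simp

text \<open>
  For invertible \<open>T\<close> the second inequality says \<open>Re T\<inverse> \<ge> c\<close>, as one sees by putting \<open>y = Tx\<close>. In
  this form no inverse is mentioned, and the condition passes to weak limits.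
\<close>

definition coercive_ops :: "'a::complex_hilbert set \<Rightarrow> real \<Rightarrow> real \<Rightarrow> ('a \<Rightarrow> 'a) set" where
  "coercive_ops U c d = {T \<in> bounded_ops U U.
     \<forall>x\<in>U. d * (norm x)\<^sup>2 \<le> Re (cinner (T x) x) \<and> c * (norm (T x))\<^sup>2 \<le> Re (cinner (T x) x)}"

lemma coercive_ops_norm_le:
  assumes T: "T \<in> coercive_ops U c d" and c: "c > 0" and x: "x \<in> U"
  shows "norm (T x) \<le> 1 / c * norm x"
proof (cases "T x = 0")
  case False
  have "c * (norm (T x))\<^sup>2 \<le> norm (T x) * norm x"
    using T x norm_cauchy_schwarz[of "T x" x] unfolding coercive_ops_def Re_cinner by force
  then have "c * norm (T x) \<le> norm x" using False by (simp add: power2_eq_square)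
  then show ?thesis using c by (simp add: field_simps)
qed (use c in simp)

text \<open>
  The norm square is a supremum of affine functions:
  \<open>\<parallel>Tx\<parallel>\<^sup>2 = sup\<^sub>y (2 Re \<langle>Tx, y\<rangle> - \<parallel>y\<parallel>\<^sup>2)\<close>. This rewrites the second condition as a family of
  inequalities that are linear in the form of \<open>T\<close>, hence closed.
\<close>

lemma compactin_coercive_ops:
  assumes U: "closed_csubspace U" and c: "c > 0"
  shows "compactin (weak_op_topology U U) (coercive_ops U c d)"
proof -
  define C where "C = {\<phi> :: 'a \<Rightarrow> 'a \<Rightarrow> complex.
    (\<forall>x. x \<in> U \<longrightarrow> d * (norm x)\<^sup>2 \<le> Re (\<phi> x x)) \<and>
    (\<forall>x y. x \<in> U \<longrightarrow> y \<in> U \<longrightarrow> c * (2 * Re (\<phi> x y) - (norm y)\<^sup>2) \<le> Re (\<phi> x x))}"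
  have "closed C"
    unfolding C_def
    by (intro closed_Collect_conj closed_Collect_all closed_Collect_imp open_Collect_const
        closed_Collect_le continuous_intros)
  then have "compactin (weak_op_topology U U) {T \<in> op_ball U U (1 / c). op_form U U T \<in> C}"
    using c by (intro compactin_weak_op_topology[OF U U]) auto
  moreover have "{T \<in> op_ball U U (1 / c). op_form U U T \<in> C} = coercive_ops U c d" (is "?L = _")
  proof (intro equalityI subsetI)
    fix T assume T: "T \<in> ?L"
    then have TU: "T \<in> bounded_ops U U" unfolding op_ball_def by blast
    have "d * (norm x)\<^sup>2 \<le> Re (cinner (T x) x) \<and> c * (norm (T x))\<^sup>2 \<le> Re (cinner (T x) x)" if x: "x \<in> U" for x
    proof
      show "d * (norm x)\<^sup>2 \<le> Re (cinner (T x) x)"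
        using T x unfolding C_def op_form_def by auto
      have Tx: "T x \<in> U" using bounded_opsD(1)[OF TU x] .
      have "c * (2 * Re (op_form U U T x (T x)) - (norm (T x))\<^sup>2) \<le> Re (op_form U U T x x)"
        using T x Tx unfolding C_def by blast
      then show "c * (norm (T x))\<^sup>2 \<le> Re (cinner (T x) x)"
        using x Tx unfolding op_form_def by (simp add: cinner_self)
    qed
    then show "T \<in> coercive_ops U c d" unfolding coercive_ops_def using TU by blast
  next
    fix T assume T: "T \<in> coercive_ops U c d"
    then have "T \<in> op_ball U U (1 / c)"
      using coercive_ops_norm_le[OF T c] unfolding op_ball_def coercive_ops_def by blast
    moreover have "op_form U U T \<in> C"
    proof -
      have "c * (2 * Re (cinner (T x) y) - (norm y)\<^sup>2) \<le> Re (cinner (T x) x)" if "x \<in> U" for x y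
      proof -
        have "0 \<le> (norm (T x - y))\<^sup>2" by simp
        then have "2 * Re (cinner (T x) y) - (norm y)\<^sup>2 \<le> (norm (T x))\<^sup>2"
          unfolding Re_cinner power2_norm_eq_inner by (simp add: inner_simps inner_commute)
        then have "c * (2 * Re (cinner (T x) y) - (norm y)\<^sup>2) \<le> c * (norm (T x))\<^sup>2"
          using c by (intro mult_left_mono) auto
        also have "\<dots> \<le> Re (cinner (T x) x)" using T that unfolding coercive_ops_def by blast
        finally show ?thesis .
      qed
      then show ?thesis using T unfolding C_def op_form_def coercive_ops_def by auto
    qed
    ultimately show "T \<in> ?L" by blast
  qed
  ultimately show ?thesis by simp
qed

section \<open>Inverses, compositions and blocks of bounded operators\<close>

lemma bop_inverse_apply:
  assumes "bij_betw T U V" "y \<in> V"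
  shows "bop_inverse U V T y \<in> U" "T (bop_inverse U V T y) = y"
proof -
  have "y \<in> T ` U" using assms bij_betw_imp_surj_on by blast
  then show "bop_inverse U V T y \<in> U" "T (bop_inverse U V T y) = y"
    unfolding bop_inverse_def using assms(2) by (simp_all add: inv_into_into f_inv_into_f)
qed

lemma bop_inverse_left: "bij_betw T U V \<Longrightarrow> x \<in> U \<Longrightarrow> bop_inverse U V T (T x) = x"
  unfolding bop_inverse_def by (auto simp: bij_betw_def inv_into_f_f)

lemma two_sided_inverse:
  assumes "\<And>x. x \<in> U \<Longrightarrow> T x \<in> V \<and> S (T x) = x" "\<And>y. y \<in> V \<Longrightarrow> S y \<in> U \<and> T (S y) = y"
    and "\<And>y. y \<notin> V \<Longrightarrow> S y = undefined"
  shows "bij_betw T U V" "bop_inverse U V T = S"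
proof -
  show bij: "bij_betw T U V" using assms by (intro bij_betwI[of T U V S]) auto
  show "bop_inverse U V T = S"
  proof
    fix y show "bop_inverse U V T y = S y"
    proof (cases "y \<in> V")
      case True
      then show ?thesis using bop_inverse_left[OF bij, of "S y"] assms(2) by simp
    qed (simp add: bop_inverse_def assms(3))
  qed
qed

lemma bop_inverse_bop_inverse:
  assumes "T \<in> bounded_ops U V" "bij_betw T U V"
  shows "bij_betw (bop_inverse U V T) V U" "bop_inverse V U (bop_inverse U V T) = T"
proof -
  have *: "bop_inverse U V T y \<in> U \<and> T (bop_inverse U V T y) = y" if "y \<in> V" for y
    using bop_inverse_apply[OF assms(2) that] by simp
  have **: "T x \<in> V \<and> bop_inverse U V T (T x) = x" if "x \<in> U" for x
    using bop_inverse_left[OF assms(2) that] bounded_opsD(1)[OF assms(1) that] by simp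
  note *** = two_sided_inverse[of V "bop_inverse U V T" U T, OF * ** bounded_opsD(2)[OF assms(1)]]
  show "bij_betw (bop_inverse U V T) V U" by (rule ***(1))
  show "bop_inverse V U (bop_inverse U V T) = T" by (rule ***(2))
qed

lemma bop_inverse_in_bounded_ops:
  assumes U: "closed_csubspace U" and V: "closed_csubspace V"
    and T: "T \<in> bounded_ops U V" "bij_betw T U V"
    and c: "c > 0" "\<And>x. x \<in> U \<Longrightarrow> c * norm x \<le> norm (T x)"
  shows "bop_inverse U V T \<in> bounded_ops V U"
proof (rule bounded_opsI[where K = "1 / c"])
  note inv = bop_inverse_apply[OF T(2)]
  note [simp] = closed_csubspaceD(4,7)[OF U] closed_csubspaceD(4,7)[OF V] bounded_opsD(3,4)[OF T(1)] inv
  show "bop_inverse U V T (x + y) = bop_inverse U V T x + bop_inverse U V T y" if "x \<in> V" "y \<in> V" for x y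
    using bop_inverse_left[OF T(2), of "bop_inverse U V T x + bop_inverse U V T y"] that by simp
  show "bop_inverse U V T (a *\<^sub>C x) = a *\<^sub>C bop_inverse U V T x" if "x \<in> V" for a x
    using bop_inverse_left[OF T(2), of "a *\<^sub>C bop_inverse U V T x"] that by simp
  show "norm (bop_inverse U V T x) \<le> 1 / c * norm x" if "x \<in> V" for x
    using c(2)[of "bop_inverse U V T x"] c(1) that by (simp add: field_simps)
  show "bop_inverse U V T x \<in> U" if "x \<in> V" for x using that by simp
  show "bop_inverse U V T x = undefined" if "x \<notin> V" for x using that by (simp add: bop_inverse_def)
qed

lemma bounded_ops_zero: "T \<in> bounded_ops U V \<Longrightarrow> closed_csubspace U \<Longrightarrow> T 0 = 0"
  using bounded_opsD(3)[of T U V 0 0] closed_csubspaceD(3)[of U] by simp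

lemma bounded_ops_scaleR: "T \<in> bounded_ops U V \<Longrightarrow> x \<in> U \<Longrightarrow> T (r *\<^sub>R x) = r *\<^sub>R T x"
  using bounded_opsD(4)[of T U V x "of_real r"] by (simp add: scaleC_of_real)

lemma bounded_ops_diff:
  "T \<in> bounded_ops U V \<Longrightarrow> closed_csubspace U \<Longrightarrow> x \<in> U \<Longrightarrow> y \<in> U \<Longrightarrow> T (x - y) = T x - T y"
  using bounded_opsD(3)[of T U V "x - y" y] closed_csubspaceD(5)[of U x y] by simp

lemma Re_ge_imp_invertible:
  assumes U: "closed_csubspace U" and T: "T \<in> bounded_ops U U" and c: "c > 0" "Re_ge U T c"
  shows "bij_betw T U U" "bop_inverse U U T \<in> bounded_ops U U"
proof -
  obtain K where K: "\<forall>x\<in>U. norm (T x) \<le> K * norm x" using bounded_opsD(5)[OF T] by blast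
  have img: "T ` U \<subseteq> U" using bounded_opsD(1)[OF T] by blast
  have coercive: "c * (norm x)\<^sup>2 \<le> inner (T x) x" if "x \<in> U" for x
    using c(2) that unfolding Re_ge_def Re_cinner by blast
  note LM = lax_milgram_on_closed_subspace[OF closed_csubspaceD(2,1)[OF U] img bounded_opsD(3)[OF T]
      bounded_ops_scaleR[OF T] _ c(1) coercive, of K]
  show bij: "bij_betw T U U" using LM(1) K by blast
  show "bop_inverse U U T \<in> bounded_ops U U"
    using bop_inverse_in_bounded_ops[OF U U T bij c(1)] LM(2) K by blast
qed

lemma coercive_opsI:
  assumes T: "T \<in> bounded_ops U U" "bij_betw T U U" and "Re_ge U T d" "Re_ge U (bop_inverse U U T) c"
  shows "T \<in> coercive_ops U c d"
proof -
  have "c * (norm (T x))\<^sup>2 \<le> Re (cinner (T x) x)" if x: "x \<in> U" for x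
  proof -
    have "c * (norm (T x))\<^sup>2 \<le> Re (cinner (bop_inverse U U T (T x)) (T x))"
      using assms(4) bounded_opsD(1)[OF T(1) x] unfolding Re_ge_def by blast
    then show ?thesis by (simp add: bop_inverse_left[OF T(2) x] Re_cinner inner_commute)
  qed
  then show ?thesis using assms unfolding coercive_ops_def Re_ge_def by blast
qed

lemma coercive_opsD:
  assumes U: "closed_csubspace U" and T: "T \<in> coercive_ops U c d" and d: "d > 0"
  shows "T \<in> bounded_ops U U" "Re_ge U T d" "bij_betw T U U"
    "bop_inverse U U T \<in> bounded_ops U U" "Re_ge U (bop_inverse U U T) c"
proof -
  show T': "T \<in> bounded_ops U U" "Re_ge U T d" using T unfolding coercive_ops_def Re_ge_def by auto
  show bij: "bij_betw T U U" and "bop_inverse U U T \<in> bounded_ops U U"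
    using Re_ge_imp_invertible[OF U T'(1) d T'(2)] by auto
  show "Re_ge U (bop_inverse U U T) c"
    unfolding Re_ge_def
  proof
    fix y assume "y \<in> U"
    note y = bop_inverse_apply[OF bij this]
    have "c * (norm (T (bop_inverse U U T y)))\<^sup>2 \<le> Re (cinner (T (bop_inverse U U T y)) (bop_inverse U U T y))"
      using T y(1) unfolding coercive_ops_def by blast
    then have "c * (norm y)\<^sup>2 \<le> Re (cinner y (bop_inverse U U T y))" unfolding y(2) .
    then show "c * (norm y)\<^sup>2 \<le> Re (cinner (bop_inverse U U T y) y)" by (simp add: Re_cinner inner_commute)
  qed
qed

lemma bounded_ops_compose:
  assumes S: "S \<in> bounded_ops U V" and T: "T \<in> bounded_ops V W" 
    and U: "\<And>x y. x \<in> U \<Longrightarrow> y \<in> U \<Longrightarrow> x + y \<in> U" "\<And>c x. x \<in> U \<Longrightarrow> c *\<^sub>C x \<in> U"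
  shows "compose U T S \<in> bounded_ops U W"
proof -
  obtain K L where K: "\<forall>x\<in>U. norm (S x) \<le> K * norm x" and L: "L \<ge> 0" "\<forall>x\<in>V. norm (T x) \<le> L * norm x"
    using bounded_opsD(5)[OF S] bounded_opsD(5)[OF T] by blast
  note [simp] = bounded_opsD(1,3,4)[OF S] bounded_opsD(1,3,4)[OF T] U
  show ?thesis
  proof (rule bounded_opsI[where K = "L * K"])
    fix x assume x: "x \<in> U"
    have "norm (T (S x)) \<le> L * norm (S x)" using L(2) x by simp
    also have "\<dots> \<le> L * (K * norm x)" using L(1) K x by (intro mult_left_mono) auto
    finally show "norm (compose U T S x) \<le> L * K * norm x" using x by (simp add: compose_def mult.assoc)
  qed (auto simp: compose_def)
qed

lemma bounded_ops_linear_combination: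
  assumes S: "S \<in> bounded_ops U V" and T: "T \<in> bounded_ops U V" 
    and U: "closed_csubspace U" and V: "closed_csubspace V"
  shows "(\<lambda>x\<in>U. S x + T x) \<in> bounded_ops U V" "(\<lambda>x\<in>U. S x - T x) \<in> bounded_ops U V"
proof -
  obtain K L where K: "\<forall>x\<in>U. norm (S x) \<le> K * norm x" and L: "\<forall>x\<in>U. norm (T x) \<le> L * norm x"
    using bounded_opsD(5)[OF S] bounded_opsD(5)[OF T] by blast
  note [simp] = bounded_opsD(1,3,4)[OF S] bounded_opsD(1,3,4)[OF T]
    closed_csubspaceD(4,5,7)[OF U] closed_csubspaceD(4,5,7)[OF V]
  show "(\<lambda>x\<in>U. S x + T x) \<in> bounded_ops U V"
  proof (rule bounded_opsI[where K = "K + L"])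
    show "norm ((\<lambda>x\<in>U. S x + T x) x) \<le> (K + L) * norm x" if "x \<in> U" for x
      using that K L norm_triangle_ineq[of "S x" "T x"] by (fastforce simp: algebra_simps)
  qed (auto simp: scaleC_add_right)
  show "(\<lambda>x\<in>U. S x - T x) \<in> bounded_ops U V"
  proof (rule bounded_opsI[where K = "K + L"])
    show "norm ((\<lambda>x\<in>U. S x - T x) x) \<le> (K + L) * norm x" if "x \<in> U" for x
      using that K L norm_triangle_ineq4[of "S x" "T x"] by (fastforce simp: algebra_simps)
  qed (auto simp: scaleC_diff_right)
qed

lemma closed_csubspace_UNIV [simp]: "closed_csubspace UNIV"
  unfolding closed_csubspace_def by simp

lemma bounded_ops_mono: "T \<in> bounded_ops U V \<Longrightarrow> V \<subseteq> W \<Longrightarrow> T \<in> bounded_ops U W"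
  unfolding bounded_ops_def by auto

lemma proj_in_bounded_ops:
  assumes U: "closed_csubspace U"
  shows "proj U \<in> bounded_ops UNIV U"
proof (rule bounded_opsI[where K = 1])
  note [simp] = proj_in[OF U] cinner_proj[OF U] closed_csubspaceD(4,7)[OF U]
  show "proj U (x + y) = proj U x + proj U y" for x y
    by (intro proj_unique[OF U]) (simp_all add: cinner_add_right)
  show "proj U (c *\<^sub>C x) = c *\<^sub>C proj U x" for c x
    by (intro proj_unique[OF U]) (simp_all add: cinner_scaleC_right)
  show "norm (proj U x) \<le> 1 * norm x" for x
  proof (cases "proj U x = 0")
    case False
    have "cinner (proj U x) x = of_real ((norm (proj U x))\<^sup>2)"
      using cinner_proj[OF U, of "proj U x" x] by (simp add: cinner_self)
    then have "(norm (proj U x))\<^sup>2 = cmod (cinner (proj U x) x)" by (simp add: norm_power)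
    also have "\<dots> \<le> norm (proj U x) * norm x" by (rule cinner_Cauchy_Schwarz)
    finally show ?thesis using False by (simp add: power2_eq_square)
  qed simp
qed (simp_all add: proj_in[OF U])

lemma block_apply: "x \<in> V \<Longrightarrow> block U V a x = proj U (a x)"
  unfolding block_def proj_def compose_def embedding_def by simp

lemma block_outside: "x \<notin> V \<Longrightarrow> block U V a x = undefined"
  unfolding block_def compose_def by simp

lemma block_in_bounded_ops:
  assumes a: "a \<in> bounded_ops UNIV UNIV" and U: "closed_csubspace U" and V: "closed_csubspace V"
  shows "block U V a \<in> bounded_ops V U"
proof -
  have "embedding V \<in> bounded_ops V UNIV"
    by (rule bounded_opsI[where K = 1]) (simp_all add: embedding_def closed_csubspaceD(4,7)[OF V])
  from bounded_ops_compose[OF bounded_ops_compose[OF this a] proj_in_bounded_ops[OF U]]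
  show ?thesis unfolding block_def proj_def by (simp add: closed_csubspaceD(4,7)[OF V])
qed

lemma onorm_on_le_iff:
  assumes T: "T \<in> bounded_ops U V" and U: "closed_csubspace U" and K: "0 \<le> K"
  shows "onorm_on U T \<le> K \<longleftrightarrow> (\<forall>x\<in>U. norm (T x) \<le> K * norm x)"
proof -
  obtain L where L: "L \<ge> 0" "\<forall>x\<in>U. norm (T x) \<le> L * norm x" using bounded_opsD(5)[OF T] by blast
  have quot: "norm (T x) / norm x \<le> C \<longleftrightarrow> norm (T x) \<le> C * norm x" if "0 \<le> C" "x \<in> U" for C x
    using that bounded_ops_zero[OF T U] by (cases "x = 0") (simp_all add: divide_le_eq)
  have "bdd_above ((\<lambda>x. norm (T x) / norm x) ` U)"
    using L quot[OF L(1)] by (intro bdd_aboveI2[where M = L]) blast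
  moreover have "U \<noteq> {}" using closed_csubspaceD(3)[OF U] by blast
  ultimately have "onorm_on U T \<le> K \<longleftrightarrow> (\<forall>x\<in>U. norm (T x) / norm x \<le> K)"
    unfolding onorm_on_def by (intro cSUP_le_iff)
  then show ?thesis using quot[OF K] by blast
qed

section \<open>Block elimination\<close>

locale orthogonal_splitting =
  fixes X0 X1 :: "'a::complex_hilbert set"
  assumes X0: "closed_csubspace X0" and X1_eq: "X1 = orth_compl X0"
begin

lemma X1: "closed_csubspace X1"
  unfolding X1_eq by (rule closed_csubspace_orth_compl)

lemma cinner_X0_X1: "x \<in> X0 \<Longrightarrow> y \<in> X1 \<Longrightarrow> cinner x y = 0 \<and> cinner y x = 0"
  unfolding X1_eq orth_compl_def using cinner_commute[of y x] by simp

lemma proj_add: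
  assumes "x \<in> X0" "y \<in> X1"
  shows "proj X0 (x + y) = x" "proj X1 (x + y) = y"
  using assms by (auto intro!: proj_unique X0 X1 simp: cinner_add_right cinner_X0_X1)

lemma decomposition: "proj X0 h + proj X1 h = h"
proof -
  have "h - proj X0 h \<in> X1"
    unfolding X1_eq orth_compl_def using cinner_proj[OF X0] by (simp add: cinner_diff_right)
  from proj_add(2)[OF proj_in[OF X0, of h] this] show ?thesis by simp
qed

lemma proj_trivial:
  shows "x \<in> X0 \<Longrightarrow> proj X0 x = x" "x \<in> X0 \<Longrightarrow> proj X1 x = 0"
    and "x \<in> X1 \<Longrightarrow> proj X0 x = 0" "x \<in> X1 \<Longrightarrow> proj X1 x = x"
  using proj_add[of x 0] proj_add[of 0 x] closed_csubspaceD(3)[OF X0] closed_csubspaceD(3)[OF X1] by auto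

lemma schur_complement_apply:
  assumes "x \<in> X1" "block X0 X1 a x \<in> X0" "inv_a00 X0 a (block X0 X1 a x) \<in> X0"
  shows "schur_complement X0 X1 a x = proj X1 (a x) - proj X1 (a (inv_a00_a01 X0 X1 a x))"
  using assms
  by (simp add: schur_complement_def a10_inv_a00_def inv_a00_a01_def block_apply compose_def)

context
  fixes a :: "'a \<Rightarrow> 'a" and \<alpha> :: real
  assumes a: "a \<in> bounded_ops UNIV UNIV" and \<alpha>: "\<alpha> > 0" and a00: "Re_ge X0 (block X0 X0 a) \<alpha>"
begin

lemma block_bounded [simp]:
  "block X0 X0 a \<in> bounded_ops X0 X0" "block X0 X1 a \<in> bounded_ops X1 X0"
  "block X1 X0 a \<in> bounded_ops X0 X1" "block X1 X1 a \<in> bounded_ops X1 X1"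
  by (intro block_in_bounded_ops a X0 X1)+

lemma a00_bij: "bij_betw (block X0 X0 a) X0 X0"
  by (rule Re_ge_imp_invertible(1)[OF X0 _ \<alpha> a00]) simp

lemma inv_a00_bounded: "inv_a00 X0 a \<in> bounded_ops X0 X0"
  unfolding inv_a00_def by (rule Re_ge_imp_invertible(2)[OF X0 _ \<alpha> a00]) simp

lemma inv_a00_inverse:
  "bij_betw (inv_a00 X0 a) X0 X0" "bop_inverse X0 X0 (inv_a00 X0 a) = block X0 X0 a"
  unfolding inv_a00_def using bop_inverse_bop_inverse[OF _ a00_bij] by simp_all

lemma a10_inv_a00_bounded: "a10_inv_a00 X0 X1 a \<in> bounded_ops X0 X1"
  unfolding a10_inv_a00_def
  by (rule bounded_ops_compose[OF inv_a00_bounded]) (simp_all add: closed_csubspaceD[OF X0])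

lemma inv_a00_a01_bounded: "inv_a00_a01 X0 X1 a \<in> bounded_ops X1 X0"
  unfolding inv_a00_a01_def
  by (rule bounded_ops_compose[OF _ inv_a00_bounded]) (simp_all add: closed_csubspaceD[OF X1])

lemma schur_complement_bounded: "schur_complement X0 X1 a \<in> bounded_ops X1 X1"
  unfolding schur_complement_def
  by (intro bounded_ops_linear_combination(2) bounded_ops_compose[OF _ a10_inv_a00_bounded] X1)
    (simp_all add: closed_csubspaceD[OF X1])

text \<open>
  For \<open>x \<in> X\<^sub>1\<close> the vector \<open>x - a\<^sub>0\<^sub>0\<inverse>a\<^sub>0\<^sub>1x\<close> is chosen such that \<open>a\<close> maps it into \<open>X\<^sub>1\<close>; what remains in
  \<open>X\<^sub>1\<close> is the Schur complement.
\<close>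

lemma elimination:
  assumes x: "x \<in> X1"
  shows "a (x - inv_a00_a01 X0 X1 a x) = schur_complement X0 X1 a x"
proof -
  let ?m = "block X0 X1 a x" and ?y = "inv_a00_a01 X0 X1 a x"
  have m: "?m \<in> X0" by (rule bounded_opsD(1)[OF _ x]) simp
  have y: "?y = inv_a00 X0 a ?m" using x by (simp add: inv_a00_a01_def compose_def)
  have im: "inv_a00 X0 a ?m \<in> X0" by (rule bounded_opsD(1)[OF inv_a00_bounded m])
  have "block X0 X0 a (inv_a00 X0 a ?m) = ?m"
    unfolding inv_a00_def by (rule bop_inverse_apply(2)[OF a00_bij m])
  then have "proj X0 (a ?y) = proj X0 (a x)" unfolding y using im x by (simp add: block_apply)
  moreover have diff: "a (x - ?y) = a x - a ?y" using bounded_ops_diff[OF a] by simp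
  ultimately have "proj X0 (a (x - ?y)) = 0"
    using bounded_ops_diff[OF proj_in_bounded_ops[OF X0]] by simp
  moreover have "proj X1 (a (x - ?y)) = schur_complement X0 X1 a x"
    unfolding schur_complement_apply[OF x m im] diff
    using bounded_ops_diff[OF proj_in_bounded_ops[OF X1]] by simp
  ultimately show ?thesis using decomposition[of "a (x - ?y)"] by simp
qed

text \<open>
  Solving \<open>a h = k\<close> with \<open>k \<in> X\<^sub>1\<close> by elimination: the \<open>X\<^sub>0\<close>-row forces
  \<open>h\<^sub>0 = - a\<^sub>0\<^sub>0\<inverse>a\<^sub>0\<^sub>1h\<^sub>1\<close>, and then the \<open>X\<^sub>1\<close>-row reads \<open>s h\<^sub>1 = k\<close>, that is \<open>(a\<inverse>)\<^sub>1\<^sub>1 = s\<inverse>\<close>.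
\<close>

lemma schur_complement_inverse:
  assumes bij: "bij_betw a UNIV UNIV"
  defines "S \<equiv> block X1 X1 (bop_inverse UNIV UNIV a)"
  shows "bij_betw (schur_complement X0 X1 a) X1 X1"
    and "bop_inverse X1 X1 (schur_complement X0 X1 a) = S"
proof -
  let ?s = "schur_complement X0 X1 a" and ?b = "bop_inverse UNIV UNIV a"
  note s = bounded_opsD(1)[OF schur_complement_bounded]
  note y = bounded_opsD(1)[OF inv_a00_a01_bounded]
  have left: "?s x \<in> X1 \<and> S (?s x) = x" if x: "x \<in> X1" for x
  proof -
    have "?b (?s x) = x - inv_a00_a01 X0 X1 a x"
      unfolding elimination[OF x, symmetric] by (rule bop_inverse_left[OF bij UNIV_I])
    then have "?b (?s x) = - inv_a00_a01 X0 X1 a x + x" by simp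
    then have "proj X1 (?b (?s x)) = x"
      using proj_add(2)[OF closed_csubspaceD(6)[OF X0 y[OF x]] x] by metis
    then show ?thesis unfolding S_def using s[OF x] by (simp add: block_apply)
  qed
  have right: "S k \<in> X1 \<and> ?s (S k) = k" if k: "k \<in> X1" for k
  proof -
    let ?h = "?b k"
    let ?x = "proj X1 ?h"
    have x: "?x \<in> X1" by (rule proj_in[OF X1])
    have ah: "a ?h = k" by (rule bop_inverse_apply(2)[OF bij UNIV_I])
    have z: "proj X0 ?h + inv_a00_a01 X0 X1 a ?x \<in> X0" (is "?z \<in> _")
      using proj_in[OF X0] y[OF x] closed_csubspaceD(4)[OF X0] by blast
    have "?h = ?z + (?x - inv_a00_a01 X0 X1 a ?x)"
      using decomposition[of ?h] by (metis add.assoc add.commute diff_add_cancel)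
    then have "k = a ?z + ?s ?x"
      using ah bounded_opsD(3)[OF a] elimination[OF x] by (metis UNIV_I)
    then have az: "a ?z = k - ?s ?x" by (metis add_diff_cancel_right')
    then have "a ?z \<in> X1" using k s[OF x] closed_csubspaceD(5)[OF X1] by simp
    then have "block X0 X0 a ?z = 0" using z by (simp add: block_apply proj_trivial(3))
    moreover have "block X0 X0 a 0 = 0" by (rule bounded_ops_zero[OF block_bounded(1) X0])
    ultimately have "?z = 0"
      using a00_bij z closed_csubspaceD(3)[OF X0] unfolding bij_betw_def inj_on_def by metis
    then have "?s ?x = k" using az bounded_ops_zero[OF a] by simp
    then show ?thesis unfolding S_def using k x by (simp add: block_apply)
  qed
  have "S k = undefined" if "k \<notin> X1" for k unfolding S_def by (rule block_outside[OF that])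
  from two_sided_inverse[of X1 ?s X1 S, OF left right this]
  show "bij_betw ?s X1 X1" "bop_inverse X1 X1 ?s = S" by auto
qed

end

text \<open>
  The set \<open>M_set\<close> depends on the two operators only through the ranges \<open>X\<^sub>0\<close> and \<open>X\<^sub>1\<close>.
\<close>

definition M_class :: "real \<Rightarrow> real \<Rightarrow> ('a \<Rightarrow> 'a) set" where
  "M_class \<alpha> \<beta> = {a \<in> bounded_ops UNIV UNIV.
        continuously_invertible UNIV UNIV a \<and>
        Re_ge X0 (block X0 X0 a) \<alpha> \<and>
        Re_ge X0 (inv_a00 X0 a) (1 / \<beta>) \<and>
        Re_ge X1 (block X1 X1 (bop_inverse UNIV UNIV a)) (1 / \<beta>) \<and>
        Re_ge X1 (bop_inverse X1 X1 (block X1 X1 (bop_inverse UNIV UNIV a))) \<alpha>}"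

lemma M_classD:
  assumes "a \<in> M_class \<alpha> \<beta>" and "\<alpha> > 0"
  shows "inv_a00 X0 a \<in> coercive_ops X0 \<alpha> (1 / \<beta>)"
    and "a10_inv_a00 X0 X1 a \<in> bounded_ops X0 X1"
    and "inv_a00_a01 X0 X1 a \<in> bounded_ops X1 X0"
    and "schur_complement X0 X1 a \<in> coercive_ops X1 (1 / \<beta>) \<alpha>"
proof -
  have a: "a \<in> bounded_ops UNIV UNIV" "Re_ge X0 (block X0 X0 a) \<alpha>" and bij: "bij_betw a UNIV UNIV"
    and re: "Re_ge X0 (inv_a00 X0 a) (1 / \<beta>)"
      "Re_ge X1 (block X1 X1 (bop_inverse UNIV UNIV a)) (1 / \<beta>)"
      "Re_ge X1 (bop_inverse X1 X1 (block X1 X1 (bop_inverse UNIV UNIV a))) \<alpha>"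
    using assms(1) unfolding M_class_def continuously_invertible_def by auto
  note facts = a(1) assms(2) a(2)
  show "a10_inv_a00 X0 X1 a \<in> bounded_ops X0 X1" by (rule a10_inv_a00_bounded[OF facts])
  show "inv_a00_a01 X0 X1 a \<in> bounded_ops X1 X0" by (rule inv_a00_a01_bounded[OF facts])
  show "inv_a00 X0 a \<in> coercive_ops X0 \<alpha> (1 / \<beta>)"
    by (rule coercive_opsI[OF inv_a00_bounded[OF facts] inv_a00_inverse(1)[OF facts] re(1)])
      (simp add: inv_a00_inverse(2)[OF facts] a(2))
  note s = schur_complement_bounded[OF facts] schur_complement_inverse[OF facts bij]
  show "schur_complement X0 X1 a \<in> coercive_ops X1 (1 / \<beta>) \<alpha>"
    using coercive_opsI[OF s(1,2)] re(2,3) s(3) bop_inverse_bop_inverse(2)[OF s(1,2)] by simp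
qed

text \<open>
  The block factorisation read backwards. With \<open>h = u + v\<close>, \<open>u \<in> X\<^sub>0\<close>, \<open>v \<in> X\<^sub>1\<close>, the operator is
  \<open>a h = w + c w + s v\<close> where \<open>w = b\<inverse>(u + d v)\<close>, a product of a lower triangular, a diagonal and an
  upper triangular operator. Each factor can be inverted:
  \<open>a\<inverse>k = (b k\<^sub>0 - d v) + v\<close> where \<open>v = s\<inverse>(k\<^sub>1 - c k\<^sub>0)\<close>.
\<close>

lemma M_class_assembled:
  assumes pos: "\<alpha> > 0" "\<beta> > 0"
    and b: "b \<in> coercive_ops X0 \<alpha> (1 / \<beta>)" and c: "c \<in> bounded_ops X0 X1"
    and d: "d \<in> bounded_ops X1 X0" and s: "s \<in> coercive_ops X1 (1 / \<beta>) \<alpha>"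
  obtains a where "a \<in> M_class \<alpha> \<beta>" "inv_a00 X0 a = b" "a10_inv_a00 X0 X1 a = c"
    "inv_a00_a01 X0 X1 a = d" "schur_complement X0 X1 a = s"
proof -
  define B where "B = bop_inverse X0 X0 b"
  define R where "R = bop_inverse X1 X1 s"
  have \<beta>': "1 / \<beta> > 0" using pos by simp
  note b' = coercive_opsD[OF X0 b \<beta>', folded B_def]
  note s' = coercive_opsD[OF X1 s pos(1), folded R_def]
  let ?P0 = "proj X0" and ?P1 = "proj X1"
  define w where "w h = B (?P0 h + d (?P1 h))" for h
  define a where "a h = w h + c (w h) + s (?P1 h)" for h
  define v where "v k = R (?P1 k - c (?P0 k))" for k
  define a' where "a' k = (b (?P0 k) - d (v k)) + v k" for k
  note P = proj_in_bounded_ops[OF X0] proj_in_bounded_ops[OF X1]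
  note UNIV_compose = bounded_ops_compose[where U = UNIV, unfolded compose_def restrict_UNIV]
  note lc = bounded_ops_linear_combination[OF _ _ closed_csubspace_UNIV, unfolded restrict_UNIV]
  note extend = bounded_ops_mono[OF _ subset_UNIV]
  have wB: "w \<in> bounded_ops UNIV X0"
    unfolding w_def by (intro UNIV_compose[OF _ b'(4)] lc(1) P UNIV_compose[OF P(2) d] X0) auto
  have aB: "a \<in> bounded_ops UNIV UNIV"
    unfolding a_def
    by (intro lc(1) closed_csubspace_UNIV extend[OF wB] extend[OF UNIV_compose[OF wB c]]
        extend[OF UNIV_compose[OF P(2) s'(1)]]) auto
  have vB: "v \<in> bounded_ops UNIV X1"
    unfolding v_def by (intro UNIV_compose[OF _ s'(4)] lc(2) P UNIV_compose[OF P(1) c] X1) auto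
  have a'B: "a' \<in> bounded_ops UNIV UNIV"
    unfolding a'_def
    by (intro lc closed_csubspace_UNIV extend[OF vB] extend[OF UNIV_compose[OF P(1) b'(1)]]
        extend[OF UNIV_compose[OF vB d]]) auto
  note mem [simp] = proj_in[OF X0] proj_in[OF X1] closed_csubspaceD(3-6)[OF X0] closed_csubspaceD(3-6)[OF X1]
    bounded_opsD(1)[OF b'(1)] bounded_opsD(1)[OF b'(4)] bounded_opsD(1)[OF s'(1)] bounded_opsD(1)[OF s'(4)]
    bounded_opsD(1)[OF c] bounded_opsD(1)[OF d] bounded_opsD(1)[OF wB] bounded_opsD(1)[OF vB]
  have bB [simp]: "b (B x) = x" "B (b x) = x" if "x \<in> X0" for x
    unfolding B_def using bop_inverse_apply(2)[OF b'(3)] bop_inverse_left[OF b'(3)] that by auto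
  have sR [simp]: "s (R x) = x" "R (s x) = x" if "x \<in> X1" for x
    unfolding R_def using bop_inverse_apply(2)[OF s'(3)] bop_inverse_left[OF s'(3)] that by auto
  have a_parts: "?P0 (a h) = w h" "?P1 (a h) = c (w h) + s (?P1 h)" for h
    using proj_add[of "w h" "c (w h) + s (?P1 h)"] unfolding a_def by (simp_all add: add.assoc)
  have a'_parts: "?P0 (a' k) = b (?P0 k) - d (v k)" "?P1 (a' k) = v k" for k
    using proj_add[of "b (?P0 k) - d (v k)" "v k"] unfolding a'_def by simp_all
  have aa': "a (a' k) = k" for k
  proof -
    have "w (a' k) = ?P0 k" unfolding w_def a'_parts by simp
    moreover have "s (?P1 (a' k)) = ?P1 k - c (?P0 k)" unfolding a'_parts v_def by simp
    ultimately show ?thesis unfolding a_def using decomposition[of k] by simp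
  qed
  have a'a: "a' (a h) = h" for h
  proof -
    have "v (a h) = ?P1 h" unfolding v_def a_parts by simp
    moreover have "b (?P0 (a h)) = ?P0 h + d (?P1 h)" unfolding a_parts w_def by simp
    ultimately show ?thesis unfolding a'_def using decomposition[of h] by simp
  qed
  have inv: "bij_betw a UNIV UNIV" "bop_inverse UNIV UNIV a = a'"
    using two_sided_inverse[of UNIV a UNIV a'] aa' a'a by auto
  have d0: "d 0 = 0" by (rule bounded_ops_zero[OF d X1])
  have s0: "s 0 = 0" by (rule bounded_ops_zero[OF s'(1) X1])
  have on_X0: "w x = B x" "?P1 (a x) = c (B x)" if "x \<in> X0" for x
    using that unfolding a_parts w_def by (simp_all add: proj_trivial d0 s0)
  have on_X1: "w x = B (d x)" "?P1 (a x) = c (B (d x)) + s x" if "x \<in> X1" for x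
    using that unfolding a_parts w_def by (simp_all add: proj_trivial)
  have a00: "block X0 X0 a = B"
  proof
    show "block X0 X0 a x = B x" for x
      by (cases "x \<in> X0") (simp_all add: block_apply a_parts on_X0 bounded_opsD(2)[OF b'(4)] block_outside)
  qed
  have eb: "inv_a00 X0 a = b"
    unfolding inv_a00_def a00 B_def by (rule bop_inverse_bop_inverse(2)[OF b'(1,3)])
  have ec: "a10_inv_a00 X0 X1 a = c"
  proof
    show "a10_inv_a00 X0 X1 a x = c x" for x
      by (cases "x \<in> X0")
        (simp_all add: a10_inv_a00_def eb compose_def block_apply on_X0 bounded_opsD(2)[OF c])
  qed
  have ed: "inv_a00_a01 X0 X1 a = d"
  proof
    show "inv_a00_a01 X0 X1 a x = d x" for x
      by (cases "x \<in> X1")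
        (simp_all add: inv_a00_a01_def eb compose_def block_apply a_parts on_X1 bounded_opsD(2)[OF d])
  qed
  have es: "schur_complement X0 X1 a = s"
  proof
    show "schur_complement X0 X1 a x = s x" for x
      by (cases "x \<in> X1")
        (simp_all add: schur_complement_def ec compose_def block_apply a_parts(1) on_X1 bounded_opsD(2)[OF s'(1)])
  qed
  have a00_ge: "Re_ge X0 (block X0 X0 a) \<alpha>" unfolding a00 by (rule b'(5))
  have R_eq: "block X1 X1 a' = R"
    using schur_complement_inverse(2)[OF aB pos(1) a00_ge inv(1)] unfolding es inv(2) R_def by simp
  have "a \<in> M_class \<alpha> \<beta>"
    unfolding M_class_def continuously_invertible_def
    using aB a'B inv(1) a00_ge b'(2) s'(2,5) bop_inverse_bop_inverse(2)[OF s'(1,3), folded R_def]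
    by (simp add: inv(2) R_eq eb)
  then show thesis using that eb ec ed es by blast
qed

end


section \<open>Compactness of the operator class\<close>

theorem theorem5p5:
  fixes A0 :: "('h0::complex_hilbert \<times> 'h1::complex_hilbert) set"
    and A1 :: "('h1 \<times> 'h2::complex_hilbert) set"
    and \<alpha> \<beta> :: real
  assumes "linear_operator A0" and "densely_defined A0" and "closed A0"
    and "linear_operator A1" and "densely_defined A1" and "closed A1"
    and "closed (Range A0)" and "closed (Range A1)" and "Range A0 = op_kernel A1"
    and "\<alpha> > 0" and "\<beta> > 0"
  shows "compactin (tau_H \<alpha> \<beta> A0 A1) (M1_set \<alpha> \<beta> A0 A1)"
proof -
  define X0 where "X0 = Range A0"
  define X1 where "X1 = Range (op_adjoint A1)"
  have splitting: "orthogonal_splitting X0 X1"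
  proof
    show "closed_csubspace X0"
      unfolding X0_def by (rule closed_csubspace_Range[OF assms(1,7)])
    show "X1 = orth_compl X0"
      unfolding X0_def X1_def assms(9) by (rule range_op_adjoint[OF assms(4,6,8)])
  qed
  interpret orthogonal_splitting X0 X1 by (rule splitting)
  have M: "M_set \<alpha> \<beta> A0 A1 = M_class \<alpha> \<beta>"
    unfolding M_set_def M_class_def Let_def X0_def[symmetric] X1_def[symmetric] by (rule refl)
  have M1: "M1_set \<alpha> \<beta> A0 A1 = {a \<in> M_class \<alpha> \<beta>.
      onorm_on X1 (inv_a00_a01 X0 X1 a) \<le> \<beta> \<and> onorm_on X0 (a10_inv_a00 X0 X1 a) \<le> \<beta>}"
    unfolding M1_set_def M Let_def X0_def[symmetric] X1_def[symmetric] by (rule refl)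
  define \<Theta> where "\<Theta> a = (inv_a00 X0 a, a10_inv_a00 X0 X1 a, inv_a00_a01 X0 X1 a, schur_complement X0 X1 a)" for a
  let ?K = "coercive_ops X0 \<alpha> (1 / \<beta>) \<times> op_ball X0 X1 \<beta> \<times> op_ball X1 X0 \<beta> \<times> coercive_ops X1 (1 / \<beta>) \<alpha>"
  let ?Y = "prod_topology (weak_op_topology X0 X0) (prod_topology (weak_op_topology X0 X1)
    (prod_topology (weak_op_topology X1 X0) (weak_op_topology X1 X1)))"
  have \<beta>0: "0 \<le> \<beta>" using assms(11) by simp
  have M1_ball: "a \<in> M1_set \<alpha> \<beta> A0 A1 \<longleftrightarrow> a \<in> M_class \<alpha> \<beta> \<and>
      inv_a00_a01 X0 X1 a \<in> op_ball X1 X0 \<beta> \<and> a10_inv_a00 X0 X1 a \<in> op_ball X0 X1 \<beta>" for a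
  proof (cases "a \<in> M_class \<alpha> \<beta>")
    case True
    note bounded = M_classD(2,3)[OF True assms(10)]
    show ?thesis
      using True bounded onorm_on_le_iff[OF bounded(1) X0 \<beta>0] onorm_on_le_iff[OF bounded(2) X1 \<beta>0]
      unfolding M1 op_ball_def by simp
  qed (simp add: M1)
  have image: "\<Theta> ` M1_set \<alpha> \<beta> A0 A1 = ?K"
  proof
    show "\<Theta> ` M1_set \<alpha> \<beta> A0 A1 \<subseteq> ?K"
      using M_classD[OF _ assms(10)] by (auto simp: M1_ball \<Theta>_def)
    show "?K \<subseteq> \<Theta> ` M1_set \<alpha> \<beta> A0 A1"
    proof clarify
      fix b c d s
      assume *: "b \<in> coercive_ops X0 \<alpha> (1 / \<beta>)" "c \<in> op_ball X0 X1 \<beta>" "d \<in> op_ball X1 X0 \<beta>"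
        "s \<in> coercive_ops X1 (1 / \<beta>) \<alpha>"
      then have "c \<in> bounded_ops X0 X1" "d \<in> bounded_ops X1 X0" unfolding op_ball_def by auto
      from M_class_assembled[OF assms(10,11) *(1) this *(4)]
      obtain a where a: "a \<in> M_class \<alpha> \<beta>" "inv_a00 X0 a = b" "a10_inv_a00 X0 X1 a = c"
        "inv_a00_a01 X0 X1 a = d" "schur_complement X0 X1 a = s" by blast
      then have "a \<in> M1_set \<alpha> \<beta> A0 A1" "\<Theta> a = (b, c, d, s)" using * by (simp_all add: M1_ball \<Theta>_def)
      then show "(b, c, d, s) \<in> \<Theta> ` M1_set \<alpha> \<beta> A0 A1" by force
    qed
  qed
  have compact: "compactin ?Y ?K"
    unfolding compactin_Times
    using assms(10,11) X0 X1 by (intro disjI2 conjI compactin_coercive_ops compactin_op_ball) auto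
  show ?thesis
    unfolding tau_H_def Let_def X0_def[symmetric] X1_def[symmetric]
  proof (rule compactin_initial_topology)
    show "M1_set \<alpha> \<beta> A0 A1 \<subseteq> M_set \<alpha> \<beta> A0 A1" unfolding M using M1_ball by blast
    show "compactin ?Y (\<Theta> ` M1_set \<alpha> \<beta> A0 A1)" unfolding image by (rule compact)
    fix f and X :: "('h1 \<Rightarrow> 'h1) topology"
    assume "(f, X) \<in> {(inv_a00 X0, weak_op_topology X0 X0),
         (a10_inv_a00 X0 X1, weak_op_topology X0 X1),
         (inv_a00_a01 X0 X1, weak_op_topology X1 X0),
         (schur_complement X0 X1, weak_op_topology X1 X1)}"
    then consider "f = inv_a00 X0" "X = weak_op_topology X0 X0"
      | "f = a10_inv_a00 X0 X1" "X = weak_op_topology X0 X1"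
      | "f = inv_a00_a01 X0 X1" "X = weak_op_topology X1 X0"
      | "f = schur_complement X0 X1" "X = weak_op_topology X1 X1"
      by blast
    then show "\<exists>g. continuous_map ?Y X g \<and> (\<forall>a\<in>M_set \<alpha> \<beta> A0 A1. f a = g (\<Theta> a))"
    proof cases
      case 1
      have "continuous_map ?Y X fst" unfolding 1 by (rule continuous_map_fst)
      then show ?thesis unfolding 1 \<Theta>_def by (intro exI[of _ fst]) simp
    next
      case 2
      have "continuous_map ?Y X (fst \<circ> snd)"
        unfolding 2 by (intro continuous_map_compose[OF continuous_map_snd] continuous_map_fst)
      then show ?thesis unfolding 2 \<Theta>_def by (intro exI[of _ "fst \<circ> snd"]) simp
    next
      case 3
      have "continuous_map ?Y X (fst \<circ> (snd \<circ> snd))"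
        unfolding 3
        by (rule continuous_map_compose[OF continuous_map_compose[OF continuous_map_snd continuous_map_snd] continuous_map_fst])
      then show ?thesis unfolding 3 \<Theta>_def by (intro exI[of _ "fst \<circ> (snd \<circ> snd)"]) simp
    next
      case 4
      have "continuous_map ?Y X (snd \<circ> (snd \<circ> snd))"
        unfolding 4
        by (rule continuous_map_compose[OF continuous_map_compose[OF continuous_map_snd continuous_map_snd] continuous_map_snd])
      then show ?thesis unfolding 4 \<Theta>_def by (intro exI[of _ "snd \<circ> (snd \<circ> snd)"]) simp
    qed
  qed
qed

end
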